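(* Let $\varphi$ be a Dini type weight satisfying the following condition: there exists a positive constant $C$ such that $$\delta\int_\delta^\pi\frac{\varphi(t)}{t^2}\,dt\le C\varphi(\delta)\qquad\text{for every }\delta\in(0,\pi].$$ Let $f=u+iv$ ($u,v$ real-valued) be a harmonic $(K,K_0)$-quasiregular mapping in $\mathbb D$ that is continuous in $\overline{\mathbb D}$, where $K\ge1$ and $K_0\ge0$ are constants. Then, for $p\in[1,\infty]$, $u\in\mathscr L_{\varphi,p}(\mathbb T)$ if and only if, for all $z\in\mathbb D$, $$\left(\int_0^{2\pi}\left(\Lambda_f(ze^{i\theta})\right)^p\,d\theta\right)^{1/p}\le C(K,p)\,\frac{\varphi(1-|z|)}{1-|z|}+C(p)\sqrt{K_0}\quad\text{if }p\in[1,\infty),$$ $$\Lambda_f(z)\le C(K)\,\frac{\varphi(1-|z|)}{1-|z|}+C\sqrt{K_0}\quad\text{if }p=\infty,$$ where $C$, $C(p)$, $C(K)$ and $C(K,p)$ are positive constants, with $C(p)$ depending only on $p$, $C(K)$ depending only on $K$, and $C(K,p)$ depending only on $K$ and $p$.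
   Context: $\mathbb D=\{z\in\mathbb C:|z|<1\}$, $\mathbb T=\partial\mathbb D$. The symbol $C$ denotes various positive constants whose values may change from one occurrence to another, and the notation $C(a,b,\ldots)$ means that the constant depends only on the given parameters $a,b,\ldots$. A harmonic mapping in $\mathbb D$ is a complex-valued twice continuously differentiable function $f=u+iv$ with $\Delta u=\Delta v=0$. Put $f_z=\frac12(f_x-if_y)$, $f_{\overline z}=\frac12(f_x+if_y)$, $\Lambda_f=|f_z|+|f_{\overline z}|$, and $J_f=|f_z|^2-|f_{\overline z}|^2$ (the Jacobian). A mapping $f$ is $(K,K_0)$-quasiregular ($K\ge1$, $K_0\ge0$ constants) if it is absolutely continuous on lines with locally $L^2$ integrable partial derivatives, $J_f\ge0$ a.e., and $\Lambda_f^2\le KJ_f+K_0$ a.e. A harmonic $(K,K_0)$-quasiregular mapping is one that is both harmonic and $(K,K_0)$-quasiregular. "Continuous in $\overline{\mathbb D}$" means that $f$ extends continuously to $\overline{\mathbb D}$; values on $\mathbb T$ are those of the extension. $E$ denotes the family of increasing concave functions $\varphi:[0,\infty)\to[0,\infty)$ with $\varphi(0)=0$. A function $\varphi\in E$ is a Dini type weight if there exist some $\delta_0>0$ and a positive constant $C$ such that $\int_0^\delta\frac{\varphi(t)}{t}\,dt\le C\varphi(\delta)$ for $0<\delta<\delta_0$. For $\varphi\in E$ and $p\in[1,\infty]$, $\mathscr L_{\varphi,p}(\mathbb T)$ is the set of $g\in L^p(\mathbb T)$ for which there is a constant $C>0$ with $\mathcal L_p[g](\xi_1,\xi_2)\le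 C\varphi(|\xi_1-\xi_2|)$ for all $\xi_1,\xi_2\in\mathbb T$, where $\mathcal L_p[g](\xi_1,\xi_2)=\left(\int_0^{2\pi}|g(e^{i\eta}\xi_1)-g(e^{i\eta}\xi_2)|^p\,d\eta\right)^{1/p}$ if $p<\infty$, and $\mathcal L_\infty[g](\xi_1,\xi_2)=|g(\xi_1)-g(\xi_2)|$.
   Formalization: C(K,p) is replaced by C(K,p)·M, with M the constant in the definition of u∈L_{φ,p} and C(K,p) also allowed to depend on φ (scaling f shows this is needed); the "if" part holds for any positive constants; "increasing" is weak, with φ≡0 excluded. *)

theory Defs
  imports "HOL-Analysis.Analysis"
begin

section \<open>Weights\<close>

text \<open>
  The class \<open>E\<close>. \emph{Increasing} is read in the weak sense, and the zero function is excluded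
  (it is the only weakly increasing concave function that is not positive on all of \<open>(0, \<infinity>)\<close>).
  In particular every strictly increasing concave function with \<open>\<phi> 0 = 0\<close> belongs to the class.
\<close>

definition weight_class :: "(real \<Rightarrow> real) set" where
  "weight_class =
    {\<phi>. mono_on {0..} \<phi> \<and> concave_on {0..} \<phi> \<and> \<phi> 0 = 0 \<and>
        (\<forall>t\<ge>0. 0 \<le> \<phi> t) \<and> (\<exists>t\<ge>0. \<phi> t \<noteq> 0)}"

text \<open>
  The Dini integral is a nonnegative integral with values in \<open>[0, \<infinity>]\<close>, since it may diverge
  at \<open>0\<close>; the bound includes its convergence.
\<close>

definition dini_weight :: "(real \<Rightarrow> real) \<Rightarrow> bool" where
  "dini_weight \<phi> \<longleftrightarrow>
    \<phi> \<in> weight_class \<and>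
    (\<exists>\<delta>0>0. \<exists>C>0. \<forall>\<delta>. 0 < \<delta> \<longrightarrow> \<delta> < \<delta>0 \<longrightarrow>
      (\<integral>\<^sup>+ t \<in> {0<..\<delta>}. ennreal (\<phi> t / t) \<partial>lborel) \<le> ennreal (C * \<phi> \<delta>))"

text \<open>
  For \<open>\<phi>\<close> in the weight class the integrand is bounded on \<open>[\<delta>, \<pi>]\<close>, so the integral converges.
\<close>

definition tail_condition :: "(real \<Rightarrow> real) \<Rightarrow> bool" where
  "tail_condition \<phi> \<longleftrightarrow>
    (\<exists>C>0. \<forall>\<delta>. 0 < \<delta> \<longrightarrow> \<delta> \<le> pi \<longrightarrow>
      \<delta> * (LINT t:{\<delta>..pi}|lborel. \<phi> t / t\<^sup>2) \<le> C * \<phi> \<delta>)"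


section \<open>Harmonic mappings\<close>

definition partial_x :: "(complex \<Rightarrow> 'a::real_normed_vector) \<Rightarrow> complex \<Rightarrow> 'a" where
  "partial_x f z = vector_derivative (\<lambda>t::real. f (z + of_real t)) (at 0)"

definition partial_y :: "(complex \<Rightarrow> 'a::real_normed_vector) \<Rightarrow> complex \<Rightarrow> 'a" where
  "partial_y f z = vector_derivative (\<lambda>t::real. f (z + \<i> * of_real t)) (at 0)"

definition C1_on :: "complex set \<Rightarrow> (complex \<Rightarrow> 'a::real_normed_vector) \<Rightarrow> bool" where
  "C1_on S f \<longleftrightarrow>
    (\<forall>z\<in>S. (\<lambda>t::real. f (z + of_real t)) differentiable (at 0) \<and>
           (\<lambda>t::real. f (z + \<i> * of_real t)) differentiable (at 0)) \<and>
    continuous_on S (partial_x f) \<and> continuous_on S (partial_y f)"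

definition C2_on :: "complex set \<Rightarrow> (complex \<Rightarrow> 'a::real_normed_vector) \<Rightarrow> bool" where
  "C2_on S f \<longleftrightarrow> C1_on S f \<and> C1_on S (partial_x f) \<and> C1_on S (partial_y f)"

definition laplacian :: "(complex \<Rightarrow> 'a::real_normed_vector) \<Rightarrow> complex \<Rightarrow> 'a" where
  "laplacian f z = partial_x (partial_x f) z + partial_y (partial_y f) z"

definition harmonic_mapping_on :: "complex set \<Rightarrow> (complex \<Rightarrow> complex) \<Rightarrow> bool" where
  "harmonic_mapping_on S f \<longleftrightarrow>
    C2_on S f \<and>
    (\<forall>z\<in>S. laplacian (\<lambda>w. Re (f w)) z = 0 \<and> laplacian (\<lambda>w. Im (f w)) z = 0)"


section \<open>Quasiregular mappings\<close>

definition d_z :: "(complex \<Rightarrow> complex) \<Rightarrow> complex \<Rightarrow> complex" where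
  "d_z f z = (partial_x f z - \<i> * partial_y f z) / 2"

definition d_zbar :: "(complex \<Rightarrow> complex) \<Rightarrow> complex \<Rightarrow> complex" where
  "d_zbar f z = (partial_x f z + \<i> * partial_y f z) / 2"

definition Lam :: "(complex \<Rightarrow> complex) \<Rightarrow> complex \<Rightarrow> real" where
  "Lam f z = cmod (d_z f z) + cmod (d_zbar f z)"

definition Jac :: "(complex \<Rightarrow> complex) \<Rightarrow> complex \<Rightarrow> real" where
  "Jac f z = (cmod (d_z f z))\<^sup>2 - (cmod (d_zbar f z))\<^sup>2"

text \<open>
  The usual \<open>\<epsilon>\<close>-\<open>\<delta>\<close> definition of absolute continuity; the finite families of nonoverlapping
  closed subintervals of \<open>[a, b]\<close> are the divisions of subsets of \<open>[a, b]\<close>.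
\<close>

definition abs_continuous_on_interval ::
    "real \<Rightarrow> real \<Rightarrow> (real \<Rightarrow> 'a::real_normed_vector) \<Rightarrow> bool" where
  "abs_continuous_on_interval a b h \<longleftrightarrow>
    (\<forall>\<epsilon>>0. \<exists>\<delta>>0. \<forall>d T. d division_of T \<longrightarrow> T \<subseteq> {a..b} \<longrightarrow>
      (\<Sum>k\<in>d. Sup k - Inf k) < \<delta> \<longrightarrow> (\<Sum>k\<in>d. norm (h (Sup k) - h (Inf k))) < \<epsilon>)"

text \<open>On each closed rectangle \<open>cbox a b\<close> inside \<open>S\<close>, for almost every horizontal and almost every
  vertical segment.\<close>

definition ACL_on :: "complex set \<Rightarrow> (complex \<Rightarrow> complex) \<Rightarrow> bool" where
  "ACL_on S f \<longleftrightarrow>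
    (\<forall>a b. cbox a b \<subseteq> S \<longrightarrow>
      (AE y in lborel. y \<in> {Im a..Im b} \<longrightarrow>
        abs_continuous_on_interval (Re a) (Re b) (\<lambda>x. f (Complex x y))) \<and>
      (AE x in lborel. x \<in> {Re a..Re b} \<longrightarrow>
        abs_continuous_on_interval (Im a) (Im b) (\<lambda>y. f (Complex x y))))"

definition locally_L2_on :: "complex set \<Rightarrow> (complex \<Rightarrow> complex) \<Rightarrow> bool" where
  "locally_L2_on S g \<longleftrightarrow>
    g \<in> borel_measurable (lebesgue_on S) \<and>
    (\<forall>T. compact T \<longrightarrow> T \<subseteq> S \<longrightarrow> integrable (lebesgue_on T) (\<lambda>z. (cmod (g z))\<^sup>2))"

definition quasiregular_on :: "complex set \<Rightarrow> real \<Rightarrow> real \<Rightarrow> (complex \<Rightarrow> complex) \<Rightarrow> bool" where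
  "quasiregular_on S K K0 f \<longleftrightarrow>
    ACL_on S f \<and> locally_L2_on S (partial_x f) \<and> locally_L2_on S (partial_y f) \<and>
    (AE z in lebesgue_on S. 0 \<le> Jac f z) \<and>
    (AE z in lebesgue_on S. (Lam f z)\<^sup>2 \<le> K * Jac f z + K0)"


section \<open>Lipschitz type spaces on the unit circle\<close>

text \<open>
  Exponents are extended reals \<open>p \<in> [1, \<infinity>]\<close>, represented in \<^typ>\<open>ennreal\<close>. Functions on the circle
  are functions on \<^typ>\<open>complex\<close> of which only the values on \<open>sphere 0 1\<close> matter.
\<close>

definition Lp_circle :: "ennreal \<Rightarrow> (complex \<Rightarrow> real) set" where
  "Lp_circle p =
    {g. (\<lambda>\<eta>. g (cis \<eta>)) \<in> borel_measurable (lebesgue_on {0..2 * pi}) \<and>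
        (if p = \<infinity> then \<exists>B. AE \<eta> in lebesgue_on {0..2 * pi}. \<bar>g (cis \<eta>)\<bar> \<le> B
         else integrable (lebesgue_on {0..2 * pi}) (\<lambda>\<eta>. \<bar>g (cis \<eta>)\<bar> powr enn2real p))}"

definition Lp_modulus :: "ennreal \<Rightarrow> (complex \<Rightarrow> real) \<Rightarrow> complex \<Rightarrow> complex \<Rightarrow> real" where
  "Lp_modulus p g \<xi>1 \<xi>2 =
    (if p = \<infinity> then \<bar>g \<xi>1 - g \<xi>2\<bar>
     else (LINT \<eta>|lebesgue_on {0..2 * pi}.
             \<bar>g (cis \<eta> * \<xi>1) - g (cis \<eta> * \<xi>2)\<bar> powr enn2real p) powr (1 / enn2real p))"

definition Lphi_bound :: "(real \<Rightarrow> real) \<Rightarrow> ennreal \<Rightarrow> real \<Rightarrow> (complex \<Rightarrow> real) \<Rightarrow> bool" where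
  "Lphi_bound \<phi> p C g \<longleftrightarrow>
    (\<forall>\<xi>1\<in>sphere 0 1. \<forall>\<xi>2\<in>sphere 0 1. Lp_modulus p g \<xi>1 \<xi>2 \<le> C * \<phi> (cmod (\<xi>1 - \<xi>2)))"

definition Lphi :: "(real \<Rightarrow> real) \<Rightarrow> ennreal \<Rightarrow> (complex \<Rightarrow> real) set" where
  "Lphi \<phi> p = {g \<in> Lp_circle p. \<exists>C>0. Lphi_bound \<phi> p C g}"


section \<open>Growth of the derivative\<close>

definition Lam_mean :: "ennreal \<Rightarrow> (complex \<Rightarrow> complex) \<Rightarrow> complex \<Rightarrow> real" where
  "Lam_mean p f z =
    (if p = \<infinity> then Lam f z
     else (LINT \<theta>|lebesgue_on {0..2 * pi}. Lam f (z * cis \<theta>) powr enn2real p)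
            powr (1 / enn2real p))"

definition Lam_growth ::
    "(real \<Rightarrow> real) \<Rightarrow> ennreal \<Rightarrow> real \<Rightarrow> (complex \<Rightarrow> complex) \<Rightarrow> real \<Rightarrow> real \<Rightarrow> bool" where
  "Lam_growth \<phi> p K0 f A B \<longleftrightarrow>
    (\<forall>z\<in>ball 0 1.
      Lam_mean p f z \<le> A * (\<phi> (1 - cmod z) / (1 - cmod z)) + B * sqrt K0)"

end

theory Submission
  imports Defs "HOL-Complex_Analysis.Complex_Analysis"
begin

text \<open>
  Let \<open>u = Re f\<close>. The gradient of \<open>u\<close> controls all of \<open>f\<close>: the Jacobian is at most
  \<open>|\<nabla>u| \<Lambda>\<^sub>f\<close>, so the quasiregularity inequality gives \<open>\<Lambda>\<^sub>f \<le> K |\<nabla>u| + sqrt K0\<close>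
  (\<open>quasiregular_Lam_le\<close>), and conversely \<open>|\<nabla>u| \<le> \<Lambda>\<^sub>f\<close>. The theorem thus compares the boundary
  modulus of continuity of a harmonic function with the growth of its gradient, as in the classical
  theorem of Hardy and Littlewood. Since \<open>u = Re G\<close> for a holomorphic \<open>G\<close>
  (\<open>harmonic_imp_Re_holomorphic\<close>), the gradient has modulus \<open>|G'|\<close>.

  From modulus to growth: Cauchy's formula, in a form that sees only the real part of \<open>G\<close> on the
  circle, bounds \<open>|G' (r \<zeta>)|\<close> by the integral of \<open>|u (\<zeta> cis t) - u \<zeta>| / |cis t - r|\<^sup>2\<close>
  over \<open>|t| \<le> pi\<close> (\<open>deriv_bound_boundary_oscillation\<close>). Taking \<open>L\<^sup>p\<close> means over rotations and
  applying Minkowski's integral inequality (\<open>circle_norm_integral\<close>) replaces the oscillation by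
  \<open>M \<phi> |t|\<close>, while \<open>|cis t - r|\<close> is comparable to \<open>max (1 - r) |t|\<close>. The part \<open>|t| \<le> 1 - r\<close>
  contributes \<open>\<phi> (1 - r) / (1 - r)\<close> up to a constant, and the tail condition says the same of the
  rest (\<open>weight_kernel_integral\<close>).

  From growth to modulus: two boundary points at distance \<open>s\<close> are joined by two radial segments of
  length \<open>s\<close> and a chord at depth \<open>s\<close>. The means of \<open>|G'|\<close> along the chord are at most a multiple
  of \<open>\<phi> s / s\<close>, because \<open>\<phi> t / t\<close> decreases, and integrate to \<open>\<phi> s\<close>; along the radii they
  integrate to the Dini integral, again at most a multiple of \<open>\<phi> s\<close>
  (\<open>Lphi_bound_small_arcs\<close>). Large \<open>s\<close> are trivial, as \<open>u\<close> is bounded and \<open>\<phi>\<close> is positive and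
  increasing.
\<close>

section \<open>Harmonic functions as real parts of holomorphic functions\<close>

lemma differentiable_along_axes_iff:
  "(\<lambda>t::real. f (z + of_real t)) differentiable (at 0) \<longleftrightarrow>
    ((\<lambda>t::real. f (z + of_real t)) has_vector_derivative partial_x f z) (at 0)"
  "(\<lambda>t::real. f (z + \<i> * of_real t)) differentiable (at 0) \<longleftrightarrow>
    ((\<lambda>t::real. f (z + \<i> * of_real t)) has_vector_derivative partial_y f z) (at 0)"
  by (simp_all add: partial_x_def partial_y_def vector_derivative_works)

lemma C1_on_has_vector_derivative:
  assumes "C1_on S h" "Complex x y \<in> S"
  shows "((\<lambda>t. h (Complex t y)) has_vector_derivative partial_x h (Complex x y)) (at x)"
    and "((\<lambda>t. h (Complex x t)) has_vector_derivative partial_y h (Complex x y)) (at y)"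
proof -
  have "((\<lambda>t::real. h (Complex x y + of_real t)) has_vector_derivative partial_x h (Complex x y)) (at (x - x))"
    using assms by (simp add: C1_on_def differentiable_along_axes_iff)
  moreover have "((\<lambda>t. t - x) has_vector_derivative 1) (at x)"
    by (auto intro!: derivative_eq_intros)
  ultimately have "((\<lambda>t. h (Complex x y + of_real t)) \<circ> (\<lambda>t. t - x) has_vector_derivative 1 *\<^sub>R partial_x h (Complex x y)) (at x)"
    by (intro vector_diff_chain_at)
  then
  show "((\<lambda>t. h (Complex t y)) has_vector_derivative partial_x h (Complex x y)) (at x)"
    by (simp add: o_def Complex_eq algebra_simps)
  have "((\<lambda>t::real. h (Complex x y + \<i> * of_real t)) has_vector_derivative partial_y h (Complex x y)) (at (y - y))"
    using assms by (simp add: C1_on_def differentiable_along_axes_iff)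
  moreover have "((\<lambda>t. t - y) has_vector_derivative 1) (at y)"
    by (auto intro!: derivative_eq_intros)
  ultimately have "((\<lambda>t. h (Complex x y + \<i> * of_real t)) \<circ> (\<lambda>t. t - y) has_vector_derivative 1 *\<^sub>R partial_y h (Complex x y)) (at y)"
    by (intro vector_diff_chain_at)
  then
  show "((\<lambda>t. h (Complex x t)) has_vector_derivative partial_y h (Complex x y)) (at y)"
    by (simp add: o_def Complex_eq algebra_simps)
qed

text \<open>
  Continuity of the partial derivatives upgrades derivatives along the two axes to a Frechet
  derivative. The criterion for jointly continuous partials lives on product spaces, so the proof
  works in real coordinates on a box around \<open>z\<close> and is transported back along
  \<open>w \<mapsto> (Re w, Im w)\<close>.
\<close>

lemma C1_on_imp_has_derivative:
  fixes h :: "complex \<Rightarrow> 'a::real_normed_vector"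
  assumes C1: "C1_on S h" and "open S" "z \<in> S"
  shows "(h has_derivative (\<lambda>w. Re w *\<^sub>R partial_x h z + Im w *\<^sub>R partial_y h z)) (at z)"
proof -
  define A where "A = (\<lambda>(x, y). Complex x y) -` S"
  have cont_C: "continuous_on UNIV (\<lambda>(x, y). Complex x y)"
    by (auto simp: split_beta Complex_eq intro!: continuous_intros)
  have "open A"
    unfolding A_def using \<open>open S\<close> cont_C by (rule open_vimage)
  moreover have "(Re z, Im z) \<in> A"
    using \<open>z \<in> S\<close> by (simp add: A_def)
  ultimately obtain X Y where XY: "open X" "open Y" "Re z \<in> X" "Im z \<in> Y" "X \<times> Y \<subseteq> A"
    by (rule open_prod_elim) auto
  obtain e where e: "e > 0" "ball (Im z) e \<subseteq> Y"
    using XY openE by blast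
  define Y' where "Y' = ball (Im z) e"
  have S: "Complex x y \<in> S" if "x \<in> X" "y \<in> Y'" for x y
  proof -
    have "(x, y) \<in> X \<times> Y" using that e(2) by (auto simp: Y'_def)
    then have "(x, y) \<in> A" using XY(5) by (rule rev_subsetD)
    then show ?thesis by (simp add: A_def)
  qed
  have "((\<lambda>(x, y). h (Complex x y)) has_derivative
      (\<lambda>(tx, ty). tx *\<^sub>R partial_x h z + blinfun_apply (blinfun_scaleR_left (partial_y h (Complex (Re z) (Im z)))) ty))
      (at (Re z, Im z) within X \<times> Y')"
  proof (rule has_derivative_partialsI[where f = "\<lambda>x y. h (Complex x y)" and fx = "\<lambda>tx. tx *\<^sub>R partial_x h z"
        and fy = "\<lambda>x y. blinfun_scaleR_left (partial_y h (Complex x y))"])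
    show "((\<lambda>x. h (Complex x (Im z))) has_derivative (\<lambda>tx. tx *\<^sub>R partial_x h z)) (at (Re z) within X)"
      using C1_on_has_vector_derivative(1)[OF C1, of "Re z" "Im z"] \<open>z \<in> S\<close>
      by (simp add: has_vector_derivative_def has_derivative_at_withinI)
    show "((\<lambda>y. h (Complex x y)) has_derivative blinfun_apply (blinfun_scaleR_left (partial_y h (Complex x y)))) (at y within Y')"
      if "x \<in> X" "y \<in> Y'" for x y
      using C1_on_has_vector_derivative(2)[OF C1 S[OF that]]
      by (simp add: has_vector_derivative_def has_derivative_at_withinI)
    have "continuous_on (X \<times> Y') (\<lambda>q. partial_y h (case q of (x, y) \<Rightarrow> Complex x y))"
    proof (rule continuous_on_compose2[of S "partial_y h"])
      show "continuous_on S (partial_y h)" using C1 by (simp add: C1_on_def)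
      show "continuous_on (X \<times> Y') (\<lambda>q. case q of (x, y) \<Rightarrow> Complex x y)"
        using cont_C continuous_on_subset by blast
    qed (use S in auto)
    then have "continuous_on (X \<times> Y') (\<lambda>(x, y). blinfun_scaleR_left (partial_y h (Complex x y)))"
      by (auto simp: split_beta intro!: bounded_linear.continuous_on[OF bounded_linear_blinfun_scaleR_left])
    then show "continuous (at (Re z, Im z) within X \<times> Y') (\<lambda>(x, y). blinfun_scaleR_left (partial_y h (Complex x y)))"
      using XY e by (auto simp: continuous_on_eq_continuous_within Y'_def)
  qed (use e in \<open>auto simp: Y'_def\<close>)
  then have *: "((\<lambda>(x, y). h (Complex x y)) has_derivative (\<lambda>(tx, ty). tx *\<^sub>R partial_x h z + ty *\<^sub>R partial_y h z)) (at (Re z, Im z))"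
    using XY e by (subst (asm) at_within_open) (auto simp: Y'_def intro!: open_Times)
  have "((\<lambda>w. (Re w, Im w)) has_derivative (\<lambda>w. (Re w, Im w))) (at z)"
    by (auto intro!: derivative_eq_intros)
  from has_derivative_compose[OF this *] show ?thesis by simp
qed

text \<open>
  The mean value theorem is applied first in \<open>x\<close>, to the difference of \<open>h\<close> between the two
  horizontal sides of a square, and then in \<open>y\<close>. The next lemma evaluates the same second difference
  in the opposite order, and the comparison of the two is the symmetry of the mixed derivatives.
\<close>

lemma second_difference_quotient_xy:
  fixes h :: "complex \<Rightarrow> real"
  assumes C1: "C1_on S h" "C1_on S (partial_x h)" and "e > 0"
    and sub: "\<And>x y. \<lbrakk>a \<le> x; x \<le> a + e; b \<le> y; y \<le> b + e\<rbrakk> \<Longrightarrow> Complex x y \<in> S"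
  shows "\<exists>x y. a < x \<and> x < a + e \<and> b < y \<and> y < b + e \<and>
    h (Complex (a + e) (b + e)) - h (Complex (a + e) b) - h (Complex a (b + e)) + h (Complex a b)
      = e\<^sup>2 * partial_y (partial_x h) (Complex x y)"
proof -
  have "\<exists>x>a. x < a + e \<and> (h (Complex (a + e) (b + e)) - h (Complex (a + e) b))
      - (h (Complex a (b + e)) - h (Complex a b))
      = (a + e - a) * (partial_x h (Complex x (b + e)) - partial_x h (Complex x b))"
    by (rule MVT2)
      (use \<open>e > 0\<close> in \<open>auto intro!: DERIV_diff C1_on_has_vector_derivative(1)[OF C1(1), unfolded has_real_derivative_iff_has_vector_derivative[symmetric]] sub\<close>)
  then obtain x where x: "a < x" "x < a + e" "(h (Complex (a + e) (b + e)) - h (Complex (a + e) b))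
      - (h (Complex a (b + e)) - h (Complex a b)) = e * (partial_x h (Complex x (b + e)) - partial_x h (Complex x b))"
    by auto
  have "\<exists>y>b. y < b + e \<and> partial_x h (Complex x (b + e)) - partial_x h (Complex x b)
      = (b + e - b) * partial_y (partial_x h) (Complex x y)"
    by (rule MVT2)
      (use \<open>e > 0\<close> x in \<open>auto intro!: C1_on_has_vector_derivative(2)[OF C1(2), unfolded has_real_derivative_iff_has_vector_derivative[symmetric]] sub\<close>)
  then obtain y where y: "b < y" "y < b + e"
    "partial_x h (Complex x (b + e)) - partial_x h (Complex x b) = e * partial_y (partial_x h) (Complex x y)"
    by auto
  show ?thesis
    by (rule exI[of _ x], rule exI[of _ y]) (use x y in \<open>auto simp: power2_eq_square\<close>)
qed

lemma second_difference_quotient_yx: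
  fixes h :: "complex \<Rightarrow> real"
  assumes C1: "C1_on S h" "C1_on S (partial_y h)" and "e > 0"
    and sub: "\<And>x y. \<lbrakk>a \<le> x; x \<le> a + e; b \<le> y; y \<le> b + e\<rbrakk> \<Longrightarrow> Complex x y \<in> S"
  shows "\<exists>x y. a < x \<and> x < a + e \<and> b < y \<and> y < b + e \<and>
    h (Complex (a + e) (b + e)) - h (Complex (a + e) b) - h (Complex a (b + e)) + h (Complex a b)
      = e\<^sup>2 * partial_x (partial_y h) (Complex x y)"
proof -
  have "\<exists>y>b. y < b + e \<and> (h (Complex (a + e) (b + e)) - h (Complex a (b + e)))
      - (h (Complex (a + e) b) - h (Complex a b))
      = (b + e - b) * (partial_y h (Complex (a + e) y) - partial_y h (Complex a y))"
    by (rule MVT2)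
      (use \<open>e > 0\<close> in \<open>auto intro!: DERIV_diff C1_on_has_vector_derivative(2)[OF C1(1), unfolded has_real_derivative_iff_has_vector_derivative[symmetric]] sub\<close>)
  then obtain y where y: "b < y" "y < b + e" "(h (Complex (a + e) (b + e)) - h (Complex a (b + e)))
      - (h (Complex (a + e) b) - h (Complex a b)) = e * (partial_y h (Complex (a + e) y) - partial_y h (Complex a y))"
    by auto
  have "\<exists>x>a. x < a + e \<and> partial_y h (Complex (a + e) y) - partial_y h (Complex a y)
      = (a + e - a) * partial_x (partial_y h) (Complex x y)"
    by (rule MVT2)
      (use \<open>e > 0\<close> y in \<open>auto intro!: C1_on_has_vector_derivative(1)[OF C1(2), unfolded has_real_derivative_iff_has_vector_derivative[symmetric]] sub\<close>)
  then obtain x where x: "a < x" "x < a + e"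
    "partial_y h (Complex (a + e) y) - partial_y h (Complex a y) = e * partial_x (partial_y h) (Complex x y)"
    by auto
  show ?thesis
    by (rule exI[of _ x], rule exI[of _ y]) (use x y in \<open>auto simp: power2_eq_square\<close>)
qed

text \<open>
  Clairaut's theorem. In every small square with corner \<open>z\<close> the two mixed derivatives share a common
  value, each at a point of its own. If they differed at \<open>z\<close>, continuity would keep them apart.
\<close>

lemma C2_on_partials_commute:
  fixes h :: "complex \<Rightarrow> real"
  assumes C2: "C2_on S h" and "open S" "z \<in> S"
  shows "partial_y (partial_x h) z = partial_x (partial_y h) z"
proof (rule ccontr)
  let ?p = "partial_y (partial_x h)" and ?q = "partial_x (partial_y h)"
  assume neq: "?p z \<noteq> ?q z"
  define d where "d = dist (?p z) (?q z)"
  have d: "d > 0" using neq by (simp add: d_def)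
  have cont: "isCont ?p z" "isCont ?q z"
    using C2 \<open>open S\<close> \<open>z \<in> S\<close> by (auto simp: C2_on_def C1_on_def continuous_on_eq_continuous_at)
  have "\<forall>\<^sub>F w in nhds z. dist (?p w) (?p z) < d / 2" "\<forall>\<^sub>F w in nhds z. dist (?q w) (?q z) < d / 2"
    using cont d unfolding isCont_def tendsto_at_iff_tendsto_nhds by (intro tendstoD; simp)+
  moreover have "\<forall>\<^sub>F w in nhds z. w \<in> S"
    using \<open>open S\<close> \<open>z \<in> S\<close> by (rule eventually_nhds_in_open)
  ultimately have "\<forall>\<^sub>F w in nhds z. dist (?p w) (?p z) < d / 2 \<and> dist (?q w) (?q z) < d / 2 \<and> w \<in> S"
    by eventually_elim auto
  then obtain r where r: "r > 0" and
    near: "\<And>w. dist w z < r \<Longrightarrow> dist (?p w) (?p z) < d / 2 \<and> dist (?q w) (?q z) < d / 2 \<and> w \<in> S"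
    unfolding eventually_nhds_metric by auto
  define e where "e = r / 3"
  have e: "e > 0" using r by (simp add: e_def)
  have box: "dist (Complex x y) z < r"
    if "Re z \<le> x" "x \<le> Re z + e" "Im z \<le> y" "y \<le> Im z + e" for x y
  proof -
    have "dist (Complex x y) z \<le> \<bar>x - Re z\<bar> + \<bar>y - Im z\<bar>"
      unfolding dist_norm using cmod_le[of "Complex x y - z"] by simp
    also have "\<dots> < r" using that r by (simp add: e_def)
    finally show ?thesis .
  qed
  have S: "Complex x y \<in> S"
    if "Re z \<le> x" "x \<le> Re z + e" "Im z \<le> y" "y \<le> Im z + e" for x y
    using near box that by blast
  have C1: "C1_on S h" "C1_on S (partial_x h)" "C1_on S (partial_y h)"
    using C2 by (auto simp: C2_on_def)
  let ?D = "h (Complex (Re z + e) (Im z + e)) - h (Complex (Re z + e) (Im z)) - h (Complex (Re z) (Im z + e))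
    + h (Complex (Re z) (Im z))"
  obtain x1 y1 where 1: "Re z < x1" "x1 < Re z + e" "Im z < y1" "y1 < Im z + e"
    "?D = e\<^sup>2 * ?p (Complex x1 y1)"
    using second_difference_quotient_xy[OF C1(1,2) e S] by blast
  obtain x2 y2 where 2: "Re z < x2" "x2 < Re z + e" "Im z < y2" "y2 < Im z + e"
    "?D = e\<^sup>2 * ?q (Complex x2 y2)"
    using second_difference_quotient_yx[OF C1(1,3) e S] by blast
  have "?p (Complex x1 y1) = ?q (Complex x2 y2)" using e 1(5) 2(5) by simp
  moreover have "dist (Complex x1 y1) z < r" "dist (Complex x2 y2) z < r"
    using 1 2 by (auto intro!: box)
  ultimately have "dist (?p z) (?q z) < d"
    using near[of "Complex x1 y1"] near[of "Complex x2 y2"] unfolding dist_real_def by (smt (verit) field_sum_of_halves)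
  then show False by (simp add: d_def)
qed

text \<open>
  The complex gradient \<open>h\<^sub>x - i h\<^sub>y\<close> satisfies the Cauchy-Riemann equations: one of them is Laplace's
  equation, the other the symmetry of the mixed derivatives. On a convex set it has a primitive \<open>G\<close>,
  and \<open>Re G - h\<close> has zero gradient, so that a constant can be absorbed into \<open>G\<close>.
\<close>

lemma harmonic_imp_Re_holomorphic:
  fixes h :: "complex \<Rightarrow> real"
  assumes C2: "C2_on S h" and lap: "\<And>z. z \<in> S \<Longrightarrow> laplacian h z = 0"
    and S: "open S" "convex S"
  shows "\<exists>G. \<forall>z\<in>S. (G has_field_derivative Complex (partial_x h z) (- partial_y h z)) (at z) \<and> Re (G z) = h z"
proof -
  define g where "g z = Complex (partial_x h z) (- partial_y h z)" for z
  have C1: "C1_on S h" "C1_on S (partial_x h)" "C1_on S (partial_y h)"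
    using C2 by (auto simp: C2_on_def)
  have g': "(g has_field_derivative Complex (partial_x (partial_x h) z) (- partial_x (partial_y h) z)) (at z)"
    if z: "z \<in> S" for z
  proof -
    note [derivative_intros] = C1_on_imp_has_derivative[OF C1(2) S(1) z] C1_on_imp_has_derivative[OF C1(3) S(1) z]
    have "partial_y (partial_y h) z = - partial_x (partial_x h) z"
      using lap[OF z] by (simp add: laplacian_def)
    moreover note C2_on_partials_commute[OF C2 S(1) z]
    ultimately show ?thesis
      unfolding has_field_derivative_def g_def Complex_eq
      by (auto intro!: derivative_eq_intros simp: complex_eq_iff algebra_simps)
  qed
  then have "g field_differentiable at z within S" if "z \<in> S" for z
    using that has_field_derivative_at_within field_differentiable_def by blast
  then have "g holomorphic_on S" by (simp add: holomorphic_on_def)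
  then obtain G where G: "\<And>z. z \<in> S \<Longrightarrow> (G has_field_derivative g z) (at z within S)"
    using holomorphic_convex_primitive' S by metis
  then have G: "(G has_field_derivative g z) (at z)" if "z \<in> S" for z
    using that at_within_open[OF that S(1)] by metis
  have "((\<lambda>z. Re (G z) - h z) has_derivative (\<lambda>w. 0)) (at z)" if z: "z \<in> S" for z
  proof -
    note [derivative_intros] = C1_on_imp_has_derivative[OF C1(1) S(1) z] G[OF z, unfolded has_field_derivative_def]
    show ?thesis by (auto intro!: derivative_eq_intros simp: g_def)
  qed
  then have "\<exists>c. \<forall>z\<in>S. Re (G z) - h z = c"
    using S(2) by (intro has_derivative_zero_constant) (auto intro: has_derivative_at_withinI)
  then obtain c where c: "\<And>z. z \<in> S \<Longrightarrow> Re (G z) - h z = c" by blast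
  show ?thesis
  proof (intro exI ballI conjI)
    fix z assume z: "z \<in> S"
    show "((\<lambda>w. G w - of_real c) has_field_derivative Complex (partial_x h z) (- partial_y h z)) (at z)"
      using G[OF z] unfolding g_def by (auto intro!: derivative_eq_intros)
    show "Re (G z - of_real c) = h z" using c[OF z] by simp
  qed
qed

text \<open>
  Partial derivatives are local, so on an open set they depend only on the values there. This is
  needed because the partial derivatives of \<open>Re f\<close> are known only on the domain.
\<close>

lemma C1_on_cong:
  assumes "C1_on S f" "open S" and eq: "\<And>z. z \<in> S \<Longrightarrow> f z = g z"
  shows "C1_on S g" and "\<And>z. z \<in> S \<Longrightarrow> partial_x g z = partial_x f z"
    and "\<And>z. z \<in> S \<Longrightarrow> partial_y g z = partial_y f z"
proof -
  have *: "((\<lambda>t::real. g (z + of_real t)) has_vector_derivative partial_x f z) (at 0) \<and>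
     ((\<lambda>t::real. g (z + \<i> * of_real t)) has_vector_derivative partial_y f z) (at 0)" if z: "z \<in> S" for z
  proof -
    have "continuous_on UNIV (\<lambda>t::real. z + of_real t)" "continuous_on UNIV (\<lambda>t::real. z + \<i> * of_real t)"
      by (intro continuous_intros)+
    from open_vimage[OF \<open>open S\<close> this(1)] open_vimage[OF \<open>open S\<close> this(2)]
    have o: "open ((\<lambda>t::real. z + of_real t) -` S)" "open ((\<lambda>t::real. z + \<i> * of_real t) -` S)" .
    have d: "((\<lambda>t::real. f (z + of_real t)) has_vector_derivative partial_x f z) (at 0) \<and>
     ((\<lambda>t::real. f (z + \<i> * of_real t)) has_vector_derivative partial_y f z) (at 0)"
      using assms(1) z unfolding C1_on_def by (auto simp: differentiable_along_axes_iff)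
    show ?thesis
      using z eq
      by (intro conjI has_vector_derivative_transform_within_open[OF conjunct1[OF d] o(1)]
          has_vector_derivative_transform_within_open[OF conjunct2[OF d] o(2)]) auto
  qed
  show x: "partial_x g z = partial_x f z" if "z \<in> S" for z
    using *[OF that] unfolding partial_x_def by (auto intro: vector_derivative_at)
  show y: "partial_y g z = partial_y f z" if "z \<in> S" for z
    using *[OF that] unfolding partial_y_def by (auto intro: vector_derivative_at)
  show "C1_on S g"
    unfolding C1_on_def
  proof (intro conjI ballI)
    show "continuous_on S (partial_x g)" "continuous_on S (partial_y g)"
      using assms(1) x y by (simp_all add: C1_on_def cong: continuous_on_cong)
  qed (use * in \<open>blast intro: differentiableI_vector\<close>)+
qed

lemma C1_on_Re:
  assumes "C1_on S f"
  shows "C1_on S (\<lambda>w. Re (f w))" and "\<And>z. z \<in> S \<Longrightarrow> partial_x (\<lambda>w. Re (f w)) z = Re (partial_x f z)"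
    and "\<And>z. z \<in> S \<Longrightarrow> partial_y (\<lambda>w. Re (f w)) z = Re (partial_y f z)"
proof -
  have *: "((\<lambda>t::real. Re (f (z + of_real t))) has_vector_derivative Re (partial_x f z)) (at 0) \<and>
     ((\<lambda>t::real. Re (f (z + \<i> * of_real t))) has_vector_derivative Re (partial_y f z)) (at 0)" if z: "z \<in> S" for z
    using assms z unfolding C1_on_def
    by (auto simp: differentiable_along_axes_iff
        intro!: bounded_linear.has_vector_derivative[OF bounded_linear_Re])
  show x: "partial_x (\<lambda>w. Re (f w)) z = Re (partial_x f z)" if "z \<in> S" for z
    using *[OF that] by (subst partial_x_def) (auto intro: vector_derivative_at)
  show y: "partial_y (\<lambda>w. Re (f w)) z = Re (partial_y f z)" if "z \<in> S" for z
    using *[OF that] by (subst partial_y_def) (auto intro: vector_derivative_at)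
  show "C1_on S (\<lambda>w. Re (f w))"
    unfolding C1_on_def
  proof (intro conjI ballI)
    show "continuous_on S (partial_x (\<lambda>w. Re (f w)))" "continuous_on S (partial_y (\<lambda>w. Re (f w)))"
      using assms x y by (auto simp: C1_on_def intro!: continuous_on_Re cong: continuous_on_cong)
  qed (use * in \<open>blast intro: differentiableI_vector\<close>)+
qed

lemma C2_on_Re:
  assumes "C2_on S f" "open S"
  shows "C2_on S (\<lambda>w. Re (f w))"
proof -
  have C1: "C1_on S f" "C1_on S (partial_x f)" "C1_on S (partial_y f)"
    using assms by (auto simp: C2_on_def)
  have "C1_on S (partial_x (\<lambda>w. Re (f w)))"
    by (rule C1_on_cong(1)[OF C1_on_Re(1)[OF C1(2)] \<open>open S\<close>]) (simp add: C1_on_Re(2)[OF C1(1)])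
  moreover have "C1_on S (partial_y (\<lambda>w. Re (f w)))"
    by (rule C1_on_cong(1)[OF C1_on_Re(1)[OF C1(3)] \<open>open S\<close>]) (simp add: C1_on_Re(3)[OF C1(1)])
  ultimately show ?thesis
    using C1_on_Re(1)[OF C1(1)] by (simp add: C2_on_def)
qed

section \<open>The derivative of a holomorphic function from the boundary values of its real part\<close>

text \<open>
  Cauchy's formula expresses \<open>G' z\<close> by the values of \<open>G\<close> on a circle. The conjugate of \<open>G\<close>
  integrates to zero against the same kernel: on the circle \<open>|\<zeta>| = \<rho>\<close> one has
  \<open>cnj \<zeta> = \<rho>\<^sup>2 / \<zeta>\<close>, and thus the integral is up to sign the conjugate of
  \<open>\<oint> \<rho>\<^sup>2 G(\<zeta>) / (\<rho>\<^sup>2 - cnj z \<zeta>)\<^sup>2 d\<zeta>\<close>, whose integrand is holomorphic in the disc.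
  Adding it leaves only the real part of \<open>G\<close>. This replaces the derivative of the Poisson formula.
\<close>

lemma has_integral_circle_Re_deriv:
  assumes G: "G holomorphic_on ball 0 1" and z: "cmod z < \<rho>" and \<rho>: "\<rho> < 1"
  shows "((\<lambda>t. of_real (Re (G (of_real \<rho> * cis t))) * (\<rho> * cis t) / (of_real \<rho> * cis t - z)\<^sup>2)
           has_integral of_real pi * deriv G z) {0..2 * pi}"
proof -
  have \<rho>0: "\<rho> > 0" using z norm_ge_zero[of z] by linarith
  have G': "continuous_on (cball 0 \<rho>) G" "G holomorphic_on ball 0 \<rho>"
    by (rule continuous_on_subset[OF holomorphic_on_imp_continuous_on[OF G]], use \<rho> in auto)
      (rule holomorphic_on_subset[OF G], use \<rho> in auto)
  have zb: "z \<in> ball 0 \<rho>" using z by simp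
  note C = Cauchy_derivative_integral_circlepath[OF G' zb]
  have "(G has_field_derivative deriv G z) (at z)"
    using G z \<rho> by (intro holomorphic_derivI[OF G]) auto
  then have "deriv G z = 1 / (2 * of_real pi * \<i>) * contour_integral (circlepath 0 \<rho>) (\<lambda>u. G u / (u - z)\<^sup>2)"
    using DERIV_unique C(2) by blast
  then have "((\<lambda>u. G u / (u - z)\<^sup>2) has_contour_integral 2 * of_real pi * \<i> * deriv G z) (circlepath 0 \<rho>)"
    using has_contour_integral_integral[OF C(1)] by (simp add: field_simps)
  then have 1: "((\<lambda>t. G (\<rho> * cis t) / (\<rho> * cis t - z)\<^sup>2 * \<rho> * \<i> * cis t) has_integral 2 * of_real pi * \<i> * deriv G z) {0..2 * pi}"
    unfolding circlepath_def by (subst (asm) has_contour_integral_part_circlepath_iff) auto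
  \<comment> \<open>The kernel that accompanies \<open>cnj G\<close> has its pole outside the closed disc of radius \<open>\<rho>\<close>.\<close>
  have nz: "of_real (\<rho>\<^sup>2) - cnj z * w \<noteq> 0" if "cmod w \<le> \<rho>" for w
  proof
    assume "of_real (\<rho>\<^sup>2) - cnj z * w = 0"
    then have "cmod z * cmod w = \<rho>\<^sup>2"
      by (metis complex_mod_cnj eq_iff_diff_eq_0 norm_mult norm_of_real abs_power2)
    moreover have "cmod z * cmod w \<le> cmod z * \<rho>" using that by (simp add: mult_left_mono)
    moreover have "cmod z * \<rho> < \<rho>\<^sup>2" using z \<rho>0 by (simp add: power2_eq_square)
    ultimately show False by linarith
  qed
  have "((\<lambda>w. G w * of_real (\<rho>\<^sup>2) / (of_real (\<rho>\<^sup>2) - cnj z * w)\<^sup>2) has_contour_integral 0) (circlepath 0 \<rho>)"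
  proof (rule Cauchy_theorem_disc)
    show "finite {}" by simp
    show "continuous_on (cball 0 \<rho>) (\<lambda>w. G w * of_real (\<rho>\<^sup>2) / (of_real (\<rho>\<^sup>2) - cnj z * w)\<^sup>2)"
      using nz by (intro continuous_intros G') auto
    have "(\<lambda>w. G w * of_real (\<rho>\<^sup>2) / (of_real (\<rho>\<^sup>2) - cnj z * w)\<^sup>2) holomorphic_on ball 0 \<rho>"
      using nz by (intro holomorphic_intros G') auto
    then show "(\<lambda>w. G w * of_real (\<rho>\<^sup>2) / (of_real (\<rho>\<^sup>2) - cnj z * w)\<^sup>2) field_differentiable at x"
      if "x \<in> ball 0 \<rho> - {}" for x
      using that by (auto intro: holomorphic_on_imp_differentiable_at)
  qed (use \<rho>0 in auto)
  then have "((\<lambda>t. G (\<rho> * cis t) * of_real (\<rho>\<^sup>2) / (of_real (\<rho>\<^sup>2) - cnj z * (\<rho> * cis t))\<^sup>2 * \<rho> * \<i> * cis t) has_integral 0) {0..2 * pi}"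
    unfolding circlepath_def by (subst (asm) has_contour_integral_part_circlepath_iff) auto
  then have "((\<lambda>t. cnj (G (\<rho> * cis t) * of_real (\<rho>\<^sup>2) / (of_real (\<rho>\<^sup>2) - cnj z * (\<rho> * cis t))\<^sup>2 * \<rho> * \<i> * cis t)) has_integral 0) {0..2 * pi}"
    by (subst has_integral_cnj[symmetric]) (simp add: o_def)
  then have "((\<lambda>t. - cnj (G (\<rho> * cis t) * of_real (\<rho>\<^sup>2) / (of_real (\<rho>\<^sup>2) - cnj z * (\<rho> * cis t))\<^sup>2 * \<rho> * \<i> * cis t)) has_integral 0) {0..2 * pi}"
    by (drule_tac has_integral_neg) simp
  moreover have "- cnj (G (\<rho> * cis t) * of_real (\<rho>\<^sup>2) / (of_real (\<rho>\<^sup>2) - cnj z * (\<rho> * cis t))\<^sup>2 * \<rho> * \<i> * cis t)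
      = cnj (G (\<rho> * cis t)) / (\<rho> * cis t - z)\<^sup>2 * \<rho> * \<i> * cis t" for t
  proof -
    define w a where "w = cis t" and "a = of_real \<rho> * w - z"
    have w: "w \<noteq> 0" "cnj w = 1 / w" by (simp_all add: w_def cis_cnj cis_inverse[symmetric] divide_simps)
    have "cmod (of_real \<rho> * w) = \<rho>" using \<rho>0 by (simp add: w_def norm_mult)
    then have a: "a \<noteq> 0" using z by (auto simp: a_def)
    have "cnj (of_real (\<rho>\<^sup>2) - cnj z * (of_real \<rho> * w)) = of_real \<rho> * a / w"
      using w by (simp add: a_def power2_eq_square field_simps)
    moreover have "- (g * of_real (\<rho>\<^sup>2) / (of_real \<rho> * a / w)\<^sup>2 * of_real \<rho> * - \<i> * (1 / w))
        = g / a\<^sup>2 * of_real \<rho> * \<i> * w" for g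
      using w(1) a \<rho>0 by (simp add: field_simps power2_eq_square)
    ultimately show ?thesis
      unfolding w_def[symmetric] a_def[symmetric]
      by (simp only: complex_cnj_mult complex_cnj_divide complex_cnj_power complex_cnj_complex_of_real complex_cnj_i w(2))
  qed
  ultimately have 2: "((\<lambda>t. cnj (G (\<rho> * cis t)) / (\<rho> * cis t - z)\<^sup>2 * \<rho> * \<i> * cis t) has_integral 0) {0..2 * pi}"
    by (simp only:)
  have "((\<lambda>t. 1 / (2 * \<i>) * (G (\<rho> * cis t) / (\<rho> * cis t - z)\<^sup>2 * \<rho> * \<i> * cis t
      + cnj (G (\<rho> * cis t)) / (\<rho> * cis t - z)\<^sup>2 * \<rho> * \<i> * cis t)) has_integral 1 / (2 * \<i>) * (2 * of_real pi * \<i> * deriv G z + 0)) {0..2 * pi}"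
    by (intro has_integral_mult_right has_integral_add 1 2)
  moreover have "1 / (2 * \<i>) * (G (\<rho> * cis t) / (\<rho> * cis t - z)\<^sup>2 * \<rho> * \<i> * cis t
      + cnj (G (\<rho> * cis t)) / (\<rho> * cis t - z)\<^sup>2 * \<rho> * \<i> * cis t)
      = of_real (Re (G (of_real \<rho> * cis t))) * (\<rho> * cis t) / (of_real \<rho> * cis t - z)\<^sup>2" for t
  proof -
    have "G (\<rho> * cis t) + cnj (G (\<rho> * cis t)) = 2 * of_real (Re (G (of_real \<rho> * cis t)))"
      by (simp add: complex_add_cnj)
    moreover have "1 / (2 * \<i>) * (2 * x / d * of_real \<rho> * \<i> * w) = x * (of_real \<rho> * w) / d" for x d w :: complex
      by (cases "d = 0") (simp_all add: field_simps)
    ultimately show ?thesis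
      by (simp only: add_divide_distrib[symmetric] distrib_right[symmetric])
  qed
  moreover have "1 / (2 * \<i>) * (2 * of_real pi * \<i> * deriv G z + 0) = of_real pi * deriv G z"
    by (simp add: field_simps)
  ultimately show ?thesis by (simp only:)
qed

text \<open>
  A constant may be subtracted from \<open>G\<close> without changing its derivative. This freedom turns values of
  \<open>Re G\<close> into oscillations, which compensate the singularity of the kernel.
\<close>

lemma deriv_bound_circle:
  assumes G: "G holomorphic_on ball 0 1" and z: "cmod z < \<rho>" and \<rho>: "\<rho> < 1"
  shows "pi * cmod (deriv G z)
    \<le> integral {0..2 * pi} (\<lambda>t. \<bar>Re (G (of_real \<rho> * cis t)) - c\<bar> * \<rho> / (cmod (of_real \<rho> * cis t - z))\<^sup>2)"
proof -
  have \<rho>0: "\<rho> > 0" using z norm_ge_zero[of z] by linarith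
  define H where "H w = G w - of_real c" for w
  have H: "H holomorphic_on ball 0 1" unfolding H_def by (intro holomorphic_intros G)
  have "G field_differentiable at z"
    using G z \<rho> by (auto intro: holomorphic_on_imp_differentiable_at)
  then have dH: "deriv H z = deriv G z"
    unfolding H_def by (subst deriv_diff) auto
  have ne: "of_real \<rho> * cis t \<noteq> z" for t
    using z \<rho>0 by (auto simp: norm_mult)
  have contG: "continuous_on UNIV (\<lambda>t. G (of_real \<rho> * cis t))"
    by (rule continuous_on_compose2[OF holomorphic_on_imp_continuous_on[OF G]])
      (use \<rho> \<rho>0 in \<open>auto intro!: continuous_intros simp: norm_mult\<close>)
  have "norm (of_real pi * deriv H z)
    \<le> integral {0..2 * pi} (\<lambda>t. \<bar>Re (H (of_real \<rho> * cis t))\<bar> * \<rho> / (cmod (of_real \<rho> * cis t - z))\<^sup>2)"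
    unfolding integral_unique[OF has_integral_circle_Re_deriv[OF H z \<rho>], symmetric]
  proof (rule integral_norm_bound_integral)
    show "(\<lambda>t. complex_of_real (Re (H (\<rho> * cis t))) * (\<rho> * cis t) / (\<rho> * cis t - z)\<^sup>2) integrable_on {0..2 * pi}"
      using has_integral_circle_Re_deriv[OF H z \<rho>] by blast
    show "(\<lambda>t. \<bar>Re (H (of_real \<rho> * cis t))\<bar> * \<rho> / (cmod (of_real \<rho> * cis t - z))\<^sup>2) integrable_on {0..2 * pi}"
      unfolding H_def
      by (intro integrable_continuous_real continuous_intros continuous_on_subset[OF contG]) (use ne in auto)
  qed (use \<rho>0 in \<open>auto simp: norm_mult norm_divide norm_power\<close>)
  then show ?thesis using dH by (simp add: H_def norm_mult)
qed

text \<open>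
  Only the real part of \<open>G\<close> is continuous up to the circle, and the bound involves only that real
  part. Hence the radius can tend to \<open>1\<close>.
\<close>

lemma deriv_bound_boundary:
  assumes G: "G holomorphic_on ball 0 1" and u: "continuous_on (cball 0 1) u"
    and Gu: "\<And>w. w \<in> ball 0 1 \<Longrightarrow> Re (G w) = u w" and z: "z \<in> ball 0 1"
  shows "pi * cmod (deriv G z) \<le> integral {0..2 * pi} (\<lambda>t. \<bar>u (cis t) - c\<bar> / (cmod (cis t - z))\<^sup>2)"
proof -
  \<comment> \<open>Radii between \<open>r\<close> and \<open>1\<close> stay away from the singularity at \<open>z\<close>.\<close>
  define r where "r = (1 + cmod z) / 2"
  have r: "cmod z < r" "r < 1" "r > 0" using z norm_ge_zero[of z] unfolding r_def by (auto simp del: norm_ge_zero)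
  let ?f = "\<lambda>\<rho> t. \<bar>u (of_real \<rho> * cis t) - c\<bar> * \<rho> / (cmod (of_real \<rho> * cis t - z))\<^sup>2"
  have ne: "of_real \<rho> * cis t \<noteq> z" if "r \<le> \<rho>" for \<rho> t
    using r that by (auto simp: norm_mult)
  have "continuous_on ({r..1} \<times> cbox 0 (2 * pi)) (\<lambda>(\<rho>, t). ?f \<rho> t)"
  proof -
    have "continuous_on ({r..1} \<times> cbox 0 (2 * pi)) (\<lambda>q. u (of_real (fst q) * cis (snd q)))"
      by (rule continuous_on_compose2[OF u]) (use r in \<open>auto intro!: continuous_intros simp: norm_mult\<close>)
    then show ?thesis
      unfolding split_beta by (intro continuous_intros) (use ne in auto)
  qed
  then have "continuous_on {r..1} (\<lambda>\<rho>. integral (cbox 0 (2 * pi)) (?f \<rho>))"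
    by (rule integral_continuous_on_param)
  then have "((\<lambda>\<rho>. integral (cbox 0 (2 * pi)) (?f \<rho>)) \<longlongrightarrow> integral (cbox 0 (2 * pi)) (?f 1)) (at 1 within {r..1})"
    unfolding continuous_on_def by (rule bspec) (use r in simp)
  then have lim: "((\<lambda>\<rho>. integral {0..2 * pi} (?f \<rho>)) \<longlongrightarrow> integral {0..2 * pi} (?f 1)) (at_left 1)"
    using r by (simp add: at_within_Icc_at_left)
  have "\<forall>\<^sub>F \<rho> in at_left 1. \<rho> \<in> {r<..<1}"
    using r eventually_at_left_real by blast
  then have "\<forall>\<^sub>F \<rho> in at_left 1. pi * cmod (deriv G z) \<le> integral {0..2 * pi} (?f \<rho>)"
  proof eventually_elim
    case (elim \<rho>)
    have "pi * cmod (deriv G z) \<le> integral {0..2 * pi} (\<lambda>t. \<bar>Re (G (of_real \<rho> * cis t)) - c\<bar> * \<rho> / (cmod (of_real \<rho> * cis t - z))\<^sup>2)"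
      using deriv_bound_circle[OF G] elim r by auto
    also have "\<dots> = integral {0..2 * pi} (?f \<rho>)"
      by (rule integral_cong) (use elim r in \<open>auto simp: Gu norm_mult\<close>)
    finally show ?case .
  qed
  then have "pi * cmod (deriv G z) \<le> integral {0..2 * pi} (?f 1)"
    by (rule tendsto_lowerbound[OF lim]) simp
  then show ?thesis by simp
qed

text \<open>
  The subtracted constant is the value at the nearest boundary point \<open>\<zeta>\<close>. The circle is parametrised
  from the antipode \<open>- \<zeta>\<close>, so that the kernel peaks at the middle \<open>s = pi\<close> of the interval and
  \<open>|s - pi|\<close> is the angular distance to \<open>\<zeta>\<close>.
\<close>

lemma deriv_bound_boundary_oscillation:
  assumes G: "G holomorphic_on ball 0 1" and u: "continuous_on (cball 0 1) u"
    and Gu: "\<And>w. w \<in> ball 0 1 \<Longrightarrow> Re (G w) = u w" and r: "0 \<le> r" "r < 1" and \<zeta>: "cmod \<zeta> = 1"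
  shows "pi * cmod (deriv G (of_real r * \<zeta>))
    \<le> integral {0..2 * pi} (\<lambda>s. \<bar>u (cis (s - pi) * \<zeta>) - u \<zeta>\<bar> / (cmod (cis (s - pi) - of_real r))\<^sup>2)"
proof -
  define H where "H w = G (- \<zeta> * w)" for w
  have H: "H holomorphic_on ball 0 1"
    unfolding H_def
  proof (rule holomorphic_on_compose_gen[of "\<lambda>w. - \<zeta> * w" "ball 0 1" G "ball 0 1", unfolded o_def])
    show "(\<lambda>w. - \<zeta> * w) holomorphic_on ball 0 1" by (intro holomorphic_intros)
  qed (use G \<zeta> in \<open>auto simp: norm_mult\<close>)
  have "(G has_field_derivative deriv G (of_real r * \<zeta>)) (at (- \<zeta> * - of_real r))"
  proof -
    have "- \<zeta> * - of_real r = of_real r * \<zeta>" by simp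
    moreover have "of_real r * \<zeta> \<in> ball 0 1" using r \<zeta> by (simp add: norm_mult)
    ultimately show ?thesis using holomorphic_derivI[OF G] by (metis open_ball)
  qed
  then have "(H has_field_derivative deriv G (of_real r * \<zeta>) * - \<zeta>) (at (- of_real r))"
    unfolding H_def by (rule DERIV_chain2[where g = "\<lambda>w. - \<zeta> * w"]) (auto intro!: derivative_eq_intros)
  then have "deriv H (- of_real r) = deriv G (of_real r * \<zeta>) * - \<zeta>"
    by (rule DERIV_imp_deriv)
  then have "pi * cmod (deriv G (of_real r * \<zeta>)) = pi * cmod (deriv H (- of_real r))"
    using \<zeta> by (simp add: norm_mult)
  also have "\<dots> \<le> integral {0..2 * pi} (\<lambda>t. \<bar>u (- \<zeta> * cis t) - u \<zeta>\<bar> / (cmod (cis t - (- of_real r)))\<^sup>2)"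
  proof (rule deriv_bound_boundary[OF H, of "\<lambda>w. u (- \<zeta> * w)"])
    show "continuous_on (cball 0 1) (\<lambda>w. u (- \<zeta> * w))"
      by (rule continuous_on_compose2[OF u]) (use \<zeta> in \<open>auto intro!: continuous_intros simp: norm_mult\<close>)
  qed (use r \<zeta> Gu in \<open>auto simp: H_def norm_mult\<close>)
  also have "\<dots> = integral {0..2 * pi} (\<lambda>s. \<bar>u (cis (s - pi) * \<zeta>) - u \<zeta>\<bar> / (cmod (cis (s - pi) - of_real r))\<^sup>2)"
  proof (rule integral_cong)
    fix s
    have "cis (s - pi) = - cis s" by (simp add: complex_eq_iff)
    moreover have "cmod (- cis s - of_real r) = cmod (cis s - (- of_real r))"
      by (metis minus_diff_commute minus_diff_eq norm_minus_cancel add.commute diff_minus_eq_add uminus_add_conv_diff)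
    ultimately show "\<bar>u (- \<zeta> * cis s) - u \<zeta>\<bar> / (cmod (cis s - (- of_real r)))\<^sup>2
      = \<bar>u (cis (s - pi) * \<zeta>) - u \<zeta>\<bar> / (cmod (cis (s - pi) - of_real r))\<^sup>2"
      by (simp add: mult.commute)
  qed
  finally show ?thesis .
qed

section \<open>Integral means over rotations\<close>

text \<open>
  The \<open>L\<^sup>p\<close> norm over the angle, with a twist at \<open>p = \<infinity>\<close>: there the function is evaluated at
  angle \<open>0\<close>. The functions of interest are \<open>\<theta> \<mapsto> F (z cis \<theta>)\<close> for all \<open>z\<close> at once, so the
  supremum over the angle comes from the quantification over \<open>z\<close>. In this form one norm covers both
  the integral means of \<open>\<Lambda>\<^sub>f\<close> and the moduli of continuity, and the case \<open>p = \<infinity>\<close> needs no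
  treatment of its own later.
\<close>

definition circle_norm :: "ennreal \<Rightarrow> (real \<Rightarrow> real) \<Rightarrow> real" where
  "circle_norm p h =
    (if p = \<infinity> then \<bar>h 0\<bar>
     else (LINT \<eta>|lebesgue_on {0..2 * pi}. \<bar>h \<eta>\<bar> powr enn2real p) powr (1 / enn2real p))"

lemma Lp_modulus_eq_circle_norm:
  "Lp_modulus p g \<xi>1 \<xi>2 = circle_norm p (\<lambda>\<eta>. g (cis \<eta> * \<xi>1) - g (cis \<eta> * \<xi>2))"
  by (simp add: Lp_modulus_def circle_norm_def)

lemma Lam_mean_eq_circle_norm: "Lam_mean p f z = circle_norm p (\<lambda>\<theta>. Lam f (z * cis \<theta>))"
  by (simp add: Lam_mean_def circle_norm_def Lam_def)

lemma enn2real_ge_1: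
  assumes "1 \<le> p" "p \<noteq> (\<infinity>::ennreal)"
  shows "1 \<le> enn2real p"
  using assms enn2real_mono[of 1 p] by (simp add: top.not_eq_extremum)

lemma continuous_on_abs_powr:
  fixes h :: "'a::topological_space \<Rightarrow> real"
  assumes "continuous_on S h" "1 \<le> q"
  shows "continuous_on S (\<lambda>x. \<bar>h x\<bar> powr q)"
  using assms by (intro continuous_on_powr' continuous_intros) auto

lemma circle_norm_finite:
  assumes h: "continuous_on {0..2 * pi} h" and p: "1 \<le> p" "p \<noteq> \<infinity>"
  shows "circle_norm p h = (integral {0..2 * pi} (\<lambda>\<eta>. \<bar>h \<eta>\<bar> powr enn2real p)) powr (1 / enn2real p)"
  using p(2) continuous_imp_integrable_real[OF continuous_on_abs_powr[OF h enn2real_ge_1[OF p]]]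
  by (simp add: circle_norm_def lebesgue_integral_eq_integral)

lemma circle_norm_mono:
  assumes "continuous_on {0..2 * pi} h" "continuous_on {0..2 * pi} k" "1 \<le> p"
    and le: "\<And>x. x \<in> {0..2 * pi} \<Longrightarrow> \<bar>h x\<bar> \<le> \<bar>k x\<bar>"
  shows "circle_norm p h \<le> circle_norm p k"
proof (cases "p = \<infinity>")
  case True
  then show ?thesis using le[of 0] by (simp add: circle_norm_def)
next
  case False
  let ?q = "enn2real p"
  have q: "1 \<le> ?q" using False assms enn2real_ge_1 by blast
  have "integral {0..2 * pi} (\<lambda>\<eta>. \<bar>h \<eta>\<bar> powr ?q) \<le> integral {0..2 * pi} (\<lambda>\<eta>. \<bar>k \<eta>\<bar> powr ?q)"
    by (intro integral_le integrable_continuous_real continuous_on_abs_powr assms q powr_mono2 le) (use q in auto)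
  then show ?thesis
    using assms False q by (simp add: circle_norm_finite) (intro powr_mono2 integral_nonneg integrable_continuous_real continuous_on_abs_powr, auto)
qed

lemma circle_norm_mult:
  assumes "1 \<le> p"
  shows "circle_norm p (\<lambda>x. c * h x) = \<bar>c\<bar> * circle_norm p h"
proof (cases "p = \<infinity>")
  case True
  then show ?thesis by (simp add: circle_norm_def abs_mult)
next
  case False
  then have q: "1 \<le> enn2real p" using assms enn2real_ge_1 by blast
  then show ?thesis using False
    by (simp add: circle_norm_def abs_mult powr_mult powr_powr)
qed

text \<open>
  The true constant \<open>(2 pi) powr (1 / p)\<close> is at most \<open>2 pi\<close>, uniformly in \<open>p\<close>.
\<close>

lemma circle_norm_bound:
  assumes h: "continuous_on {0..2 * pi} h" and p: "1 \<le> p" and b: "\<And>x. x \<in> {0..2 * pi} \<Longrightarrow> \<bar>h x\<bar> \<le> b"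
  shows "circle_norm p h \<le> 2 * pi * b"
proof -
  have b0: "0 \<le> b" using b[of 0] by simp
  have pi1: "1 \<le> 2 * pi" using pi_ge_two by linarith
  show ?thesis
  proof (cases "p = \<infinity>")
    case True
    then have "circle_norm p h \<le> 1 * b" using b[of 0] by (simp add: circle_norm_def)
    also have "\<dots> \<le> 2 * pi * b" using b0 pi1 by (intro mult_right_mono)
    finally show ?thesis .
  next
    case False
    let ?q = "enn2real p"
    have q: "1 \<le> ?q" using False p enn2real_ge_1 by blast
    have "circle_norm p h \<le> circle_norm p (\<lambda>x. b)"
      using b b0 by (intro circle_norm_mono h p) (auto intro: order_trans)
    also have "\<dots> = (2 * pi) powr (1 / ?q) * b"
      using q b0 False p by (simp add: circle_norm_finite powr_mult powr_powr)
    also have "\<dots> \<le> (2 * pi) powr 1 * b"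
      using q b0 pi1 by (intro mult_right_mono powr_mono) auto
    finally show ?thesis using pi1 by simp
  qed
qed

text \<open>
  Multiplicative constants are irrelevant for the growth conditions, so a quasi-triangle inequality
  is enough. It comes from \<open>|a + b| \<le> 2 max |a| |b|\<close>.
\<close>

lemma circle_norm_add:
  assumes h: "continuous_on {0..2 * pi} h" and k: "continuous_on {0..2 * pi} k" and p: "1 \<le> p"
  shows "circle_norm p (\<lambda>x. h x + k x) \<le> 4 * (circle_norm p h + circle_norm p k)"
proof (cases "p = \<infinity>")
  case True
  then show ?thesis by (simp add: circle_norm_def)
next
  case False
  let ?q = "enn2real p"
  have q: "1 \<le> ?q" using False p enn2real_ge_1 by blast
  define A B where "A = integral {0..2 * pi} (\<lambda>\<eta>. \<bar>h \<eta>\<bar> powr ?q)" and "B = integral {0..2 * pi} (\<lambda>\<eta>. \<bar>k \<eta>\<bar> powr ?q)"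
  note int = integrable_continuous_real[OF continuous_on_abs_powr[OF _ q]]
  have AB: "0 \<le> A" "0 \<le> B"
    unfolding A_def B_def by (intro integral_nonneg int h k; simp)+
  have pw: "\<bar>h x + k x\<bar> powr ?q \<le> 2 powr ?q * (\<bar>h x\<bar> powr ?q + \<bar>k x\<bar> powr ?q)" for x
  proof -
    have "\<bar>h x + k x\<bar> powr ?q \<le> (2 * max \<bar>h x\<bar> \<bar>k x\<bar>) powr ?q"
      by (rule powr_mono2) (use q in auto)
    also have "\<dots> = 2 powr ?q * max \<bar>h x\<bar> \<bar>k x\<bar> powr ?q" by (simp add: powr_mult)
    also have "\<dots> \<le> 2 powr ?q * (\<bar>h x\<bar> powr ?q + \<bar>k x\<bar> powr ?q)"
      by (intro mult_left_mono) (auto simp: max_def)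
    finally show ?thesis .
  qed
  have "integral {0..2 * pi} (\<lambda>\<eta>. \<bar>h \<eta> + k \<eta>\<bar> powr ?q)
      \<le> integral {0..2 * pi} (\<lambda>\<eta>. 2 powr ?q * (\<bar>h \<eta>\<bar> powr ?q + \<bar>k \<eta>\<bar> powr ?q))"
  proof (rule integral_le)
    show "(\<lambda>\<eta>. \<bar>h \<eta> + k \<eta>\<bar> powr ?q) integrable_on {0..2 * pi}"
      by (intro int continuous_intros h k)
    show "(\<lambda>\<eta>. 2 powr ?q * (\<bar>h \<eta>\<bar> powr ?q + \<bar>k \<eta>\<bar> powr ?q)) integrable_on {0..2 * pi}"
      by (intro integrable_on_mult_right integrable_add int h k)
  qed (rule pw)
  also have "\<dots> = 2 powr ?q * (A + B)"
    unfolding A_def B_def by (subst integral_add[symmetric]) (auto intro!: int h k)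
  also have "\<dots> \<le> 2 powr ?q * (2 powr ?q * max A B)"
  proof (intro mult_left_mono)
    have "A + B \<le> 2 * max A B" by auto
    also have "\<dots> \<le> 2 powr ?q * max A B"
      using powr_mono[of 1 ?q 2] q AB by (intro mult_right_mono) auto
    finally show "A + B \<le> 2 powr ?q * max A B" .
  qed auto
  also have "\<dots> = 4 powr ?q * max A B"
    using powr_mult[of 2 2 ?q] by simp
  finally have "integral {0..2 * pi} (\<lambda>\<eta>. \<bar>h \<eta> + k \<eta>\<bar> powr ?q) powr (1 / ?q) \<le> (4 powr ?q * max A B) powr (1 / ?q)"
    by (intro powr_mono2 integral_nonneg int continuous_intros h k) (use q in auto)
  also have "\<dots> = 4 * max A B powr (1 / ?q)"
    using q AB by (simp add: powr_mult powr_powr)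
  also have "\<dots> \<le> 4 * (A powr (1 / ?q) + B powr (1 / ?q))"
    by (intro mult_left_mono) (auto simp: max_def)
  finally show ?thesis
    using False p h k by (simp add: circle_norm_finite A_def B_def continuous_intros)
qed

lemma continuous_on_section:
  assumes F: "continuous_on (A \<times> B) (\<lambda>(x, t). F x t)"
  shows "x \<in> A \<Longrightarrow> continuous_on B (F x)" and "t \<in> B \<Longrightarrow> continuous_on A (\<lambda>x. F x t)"
proof -
  show "continuous_on B (F x)" if "x \<in> A"
  proof -
    have "continuous_on B (\<lambda>t. case (x, t) of (x, t) \<Rightarrow> F x t)"
      by (rule continuous_on_compose2[OF F]) (use that in \<open>auto intro!: continuous_intros\<close>)
    then show ?thesis by simp
  qed
  show "continuous_on A (\<lambda>x. F x t)" if "t \<in> B"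
  proof -
    have "continuous_on A (\<lambda>x. case (x, t) of (x, t) \<Rightarrow> F x t)"
      by (rule continuous_on_compose2[OF F]) (use that in \<open>auto intro!: continuous_intros\<close>)
    then show ?thesis by simp
  qed
qed

text \<open>
  Interchanging the order of integration is done with nonnegative integrals over the whole line,
  where it costs no integrability argument. This lemma translates to and from integrals over intervals.
\<close>

lemma nn_integral_continuous_interval:
  fixes g :: "real \<Rightarrow> real"
  assumes g: "continuous_on {a..b} g" and nn: "\<And>x. x \<in> {a..b} \<Longrightarrow> 0 \<le> g x"
  shows "(\<integral>\<^sup>+x. ennreal (indicator {a..b} x * g x) \<partial>lborel) = ennreal (integral {a..b} g)"
proof -
  have si: "set_integrable lborel {a..b} g" by (rule borel_integrable_atLeastAtMost'[OF g])
  have "(\<integral>\<^sup>+x. ennreal (indicator {a..b} x * g x) \<partial>lborel) = ennreal (LINT x|lborel. indicator {a..b} x * g x)"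
    by (rule nn_integral_eq_integral) (use si nn in \<open>auto simp: set_integrable_def indicator_def\<close>)
  also have "(LINT x|lborel. indicator {a..b} x * g x) = integral {a..b} g"
    using set_borel_integral_eq_integral(2)[OF si] by (simp add: set_lebesgue_integral_def)
  finally show ?thesis .
qed

text \<open>
  Young's inequality for \<open>x / v\<close> and \<open>y\<close> with exponents \<open>q\<close> and \<open>q / (q - 1)\<close>, multiplied by
  \<open>v\<close>. In this form it also holds for \<open>q = 1\<close>.
\<close>

lemma weighted_Young:
  fixes x y v q :: real
  assumes "0 \<le> x" "0 < y" "0 < v" "1 \<le> q"
  shows "x * y powr (q - 1) \<le> (1 / q) * (x powr q * v powr (1 - q)) + (1 - 1 / q) * y powr q * v"
proof (cases "x = 0")
  case True
  then show ?thesis using assms by simp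
next
  case False
  then have x: "0 < x" using assms by simp
  have "((x / v) powr q) powr (1 / q) * (y powr q) powr (1 - 1 / q) \<le> (1 / q) * (x / v) powr q + (1 - 1 / q) * y powr q"
    by (rule Youngs_inequality_0) (use assms x in auto)
  also have "((x / v) powr q) powr (1 / q) * (y powr q) powr (1 - 1 / q) = (x / v) * y powr (q - 1)"
    using assms x by (simp add: powr_powr right_diff_distrib)
  finally have "v * ((x / v) * y powr (q - 1)) \<le> v * ((1 / q) * (x / v) powr q + (1 - 1 / q) * y powr q)"
    using assms by (intro mult_left_mono) auto
  moreover have "v * (x / v) powr q = x powr q * v powr (1 - q)"
    using assms x by (simp add: powr_divide powr_diff)
  ultimately show ?thesis
    using assms by (simp add: algebra_simps)
qed

text \<open>
  Jensen's inequality for the \<open>q\<close>-th power, the function \<open>g / V\<close> and the probability measure with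
  density \<open>V / I\<close>. It follows by integrating Young's inequality with \<open>y\<close> the mean of \<open>g / V\<close>; the
  powers of \<open>y\<close> then cancel. The right-hand side may be infinite.
\<close>

lemma weighted_Jensen:
  fixes g V :: "real \<Rightarrow> real" and q :: real
  assumes q: "1 \<le> q" and V: "\<And>t. 0 < V t" "V \<in> borel_measurable borel"
    and g: "continuous_on {c..d} g" "\<And>t. t \<in> {c..d} \<Longrightarrow> 0 \<le> g t"
    and I: "(\<integral>\<^sup>+t. ennreal (indicator {c..d} t * V t) \<partial>lborel) = ennreal I" "0 < I"
  shows "ennreal (integral {c..d} g powr q)
    \<le> ennreal (I powr (q - 1)) * (\<integral>\<^sup>+t. ennreal ((indicator {c..d} t * g t) powr q * V t powr (1 - q)) \<partial>lborel)"
    (is "_ \<le> _ * ?T")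
proof -
  define S where "S = integral {c..d} g"
  have S0: "0 \<le> S" unfolding S_def using g by (intro integral_nonneg integrable_continuous_real)
  note [measurable] = V(2)
  have mg[measurable]: "(\<lambda>t. indicator {c..d} t * g t) \<in> borel_measurable borel"
    using borel_measurable_continuous_on_indicator[OF _ g(1)] by simp
  show ?thesis
  proof (cases "S = 0 \<or> ?T = \<infinity>")
    case True
    then show ?thesis using I(2) q by (auto simp: S_def ennreal_mult_top)
  next
    case False
    then have S: "0 < S" using S0 by simp
    obtain \<tau> where \<tau>: "?T = ennreal \<tau>" "0 \<le> \<tau>" using False by (cases ?T) auto
    define y where "y = S / I"
    have y: "0 < y" using S I by (simp add: y_def)
    have "(\<integral>\<^sup>+t. ennreal (indicator {c..d} t * g t) \<partial>lborel) = ennreal S"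
      unfolding S_def by (rule nn_integral_continuous_interval) (use g in auto)
    then have "ennreal (S * y powr (q - 1)) = ennreal (y powr (q - 1)) * (\<integral>\<^sup>+t. ennreal (indicator {c..d} t * g t) \<partial>lborel)"
      by (simp add: ennreal_mult'[symmetric] S0 mult.commute)
    also have "\<dots> = (\<integral>\<^sup>+t. ennreal (y powr (q - 1)) * ennreal (indicator {c..d} t * g t) \<partial>lborel)"
      by (rule nn_integral_cmult[symmetric]) measurable
    also have "\<dots> \<le> (\<integral>\<^sup>+t. ennreal (1 / q) * ennreal ((indicator {c..d} t * g t) powr q * V t powr (1 - q))
        + ennreal ((1 - 1 / q) * y powr q) * ennreal (indicator {c..d} t * V t) \<partial>lborel)"
    proof (rule nn_integral_mono)
      fix t
      show "ennreal (y powr (q - 1)) * ennreal (indicator {c..d} t * g t)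
        \<le> ennreal (1 / q) * ennreal ((indicator {c..d} t * g t) powr q * V t powr (1 - q))
        + ennreal ((1 - 1 / q) * y powr q) * ennreal (indicator {c..d} t * V t)"
      proof (cases "t \<in> {c..d}")
        case True
        then show ?thesis
          using weighted_Young[of "g t" y "V t" q] g(2)[OF True] V(1)[of t] y q
          by (simp add: ennreal_mult'[symmetric] ennreal_plus[symmetric] mult.commute del: ennreal_plus)
      qed auto
    qed
    also have "\<dots> = ennreal (1 / q) * ?T + ennreal ((1 - 1 / q) * y powr q) * ennreal I"
      by (subst nn_integral_add) (auto simp: nn_integral_cmult I(1))
    also have "\<dots> = ennreal ((1 / q) * \<tau> + (1 - 1 / q) * y powr q * I)"
      using \<tau> q I by (simp add: ennreal_mult'[symmetric] ennreal_plus[symmetric] del: ennreal_plus)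
    finally have "S * y powr (q - 1) \<le> (1 / q) * \<tau> + (1 - 1 / q) * y powr q * I"
      using \<tau> q I by (subst (asm) ennreal_le_iff) auto
    moreover have "S * y powr (q - 1) = I * y powr q"
      using y I(2) by (simp add: y_def powr_diff field_simps)
    ultimately have "(1 / q) * (I * y powr q) \<le> (1 / q) * \<tau>" by (simp add: algebra_simps)
    then have "I * y powr q \<le> \<tau>" using q by (simp add: field_simps)
    moreover have "S powr q = I powr (q - 1) * (I * y powr q)"
      using S I(2) by (simp add: y_def powr_divide powr_diff)
    ultimately have "S powr q \<le> I powr (q - 1) * \<tau>" by (simp add: mult_left_mono)
    then show ?thesis
      unfolding \<tau> S_def[symmetric] by (simp add: ennreal_mult'[symmetric] ennreal_leI)
  qed
qed

text \<open>
  Minkowski's integral inequality, in the form in which the norms of the sections are replaced by an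
  arbitrary majorant \<open>W\<close>. Jensen's inequality with the weight \<open>W\<close> makes the integrand
  \<open>F\<^sup>q W\<^sup>1\<^sup>-\<^sup>q\<close>; after Fubini the inner integral of \<open>F\<^sup>q\<close> is at most \<open>W\<^sup>q\<close>, and what remains is
  the integral of \<open>W\<close>. The summand \<open>\<epsilon>\<close> keeps the weight positive where \<open>W\<close> vanishes.
\<close>

lemma minkowski_integral:
  fixes F :: "real \<Rightarrow> real \<Rightarrow> real"
  assumes q: "1 \<le> q" and cd: "c < d" and \<epsilon>: "0 < \<epsilon>"
    and F: "continuous_on ({a..b} \<times> {c..d}) (\<lambda>(x, t). F x t)"
    and nn: "\<And>x t. \<lbrakk>x \<in> {a..b}; t \<in> {c..d}\<rbrakk> \<Longrightarrow> 0 \<le> F x t"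
    and W: "set_integrable lborel {c..d} W"
    and le: "\<And>t. t \<in> {c..d} \<Longrightarrow> integral {a..b} (\<lambda>x. F x t powr q) powr (1 / q) \<le> W t"
  shows "integral {a..b} (\<lambda>x. integral {c..d} (F x) powr q) powr (1 / q) \<le> (LINT t:{c..d}|lborel. W t) + \<epsilon> * (d - c)"
proof -
  define V where "V t = indicator {c..d} t * W t + \<epsilon>" for t
  define I where "I = (LINT t:{c..d}|lborel. W t) + \<epsilon> * (d - c)"
  define \<Psi> where "\<Psi> z = indicator ({a..b} \<times> {c..d}) z * (case z of (x, t) \<Rightarrow> F x t)" for z
  have W0: "0 \<le> W t" if "t \<in> {c..d}" for t
    using le[OF that] powr_ge_zero order_trans by blast
  have V0: "0 < V t" for t
    using W0[of t] \<epsilon> by (auto simp: V_def indicator_def)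
  have mV[measurable]: "V \<in> borel_measurable borel"
    using W unfolding V_def set_integrable_def by (auto dest!: borel_measurable_integrable)
  have m\<Psi>[measurable]: "\<Psi> \<in> borel_measurable (borel \<Otimes>\<^sub>M borel)"
    using borel_measurable_continuous_on_indicator[OF _ F] unfolding \<Psi>_def borel_prod
    by (simp add: closed_Times)
  have "0 \<le> (LINT t:{c..d}|lborel. W t)"
    unfolding set_lebesgue_integral_def using W0 by (intro integral_nonneg_AE) (auto simp: indicator_def)
  then have I0: "0 < I" using \<epsilon> cd by (simp add: I_def add_nonneg_pos)
  have siV: "set_integrable lborel {c..d} V" and LV: "(LINT t:{c..d}|lborel. V t) = I"
  proof -
    have c: "set_integrable lborel {c..d} (\<lambda>_. \<epsilon>)"
      by (intro borel_integrable_atLeastAtMost' continuous_intros)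
    have "set_integrable lborel {c..d} V \<longleftrightarrow> set_integrable lborel {c..d} (\<lambda>t. W t + \<epsilon>)"
      by (rule set_integrable_cong) (auto simp: V_def)
    then show "set_integrable lborel {c..d} V" using set_integral_add(1)[OF W c] by simp
    have "(LINT t:{c..d}|lborel. V t) = (LINT t:{c..d}|lborel. W t + \<epsilon>)"
      by (rule set_lebesgue_integral_cong) (auto simp: V_def)
    also have "\<dots> = (LINT t:{c..d}|lborel. W t) + (LINT t:{c..d}|lborel. \<epsilon>)"
      by (rule set_integral_add(2)[OF W c])
    also have "(LINT t:{c..d}|lborel. \<epsilon>) = \<epsilon> * (d - c)"
      using cd by (simp add: set_lebesgue_integral_def)
    finally show "(LINT t:{c..d}|lborel. V t) = I" by (simp add: I_def)
  qed
  have I: "(\<integral>\<^sup>+t. ennreal (indicator {c..d} t * V t) \<partial>lborel) = ennreal I"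
    using siV LV less_imp_le[OF V0] unfolding set_integrable_def set_lebesgue_integral_def
    by (subst nn_integral_eq_integral) auto
  note cont_x = continuous_on_section(1)[OF F] and cont_t = continuous_on_section(2)[OF F]
  define S where "S x = integral {c..d} (F x)" for x
  have S0: "0 \<le> S x" if "x \<in> {a..b}" for x
    unfolding S_def using cont_x nn that by (intro integral_nonneg integrable_continuous_real) auto
  have contS: "continuous_on {a..b} S"
    unfolding S_def using integral_continuous_on_param[of "{a..b}" c d F] F by simp
  have contSq: "continuous_on {a..b} (\<lambda>x. S x powr q)"
    using contS S0 q by (intro continuous_on_powr' continuous_intros) auto
  have "ennreal (integral {a..b} (\<lambda>x. S x powr q)) = (\<integral>\<^sup>+x. ennreal (indicator {a..b} x * S x powr q) \<partial>lborel)"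
    by (rule nn_integral_continuous_interval[symmetric]) (use contSq in auto)
  also have "\<dots> \<le> (\<integral>\<^sup>+x. ennreal (I powr (q - 1)) * (\<integral>\<^sup>+t. ennreal (\<Psi> (x, t) powr q * V t powr (1 - q)) \<partial>lborel) \<partial>lborel)"
  proof (rule nn_integral_mono)
    fix x
    show "ennreal (indicator {a..b} x * S x powr q)
      \<le> ennreal (I powr (q - 1)) * (\<integral>\<^sup>+t. ennreal (\<Psi> (x, t) powr q * V t powr (1 - q)) \<partial>lborel)"
    proof (cases "x \<in> {a..b}")
      case True
      then have "\<Psi> (x, t) = indicator {c..d} t * F x t" for t by (simp add: \<Psi>_def indicator_def)
      then show ?thesis
        using weighted_Jensen[OF q V0 mV cont_x[OF True] nn[OF True] I I0] True by (simp add: S_def)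
    qed simp
  qed
  also have "\<dots> = ennreal (I powr (q - 1)) * (\<integral>\<^sup>+x. (\<integral>\<^sup>+t. ennreal (\<Psi> (x, t) powr q * V t powr (1 - q)) \<partial>lborel) \<partial>lborel)"
    by (rule nn_integral_cmult) measurable
  also have "(\<integral>\<^sup>+x. (\<integral>\<^sup>+t. ennreal (\<Psi> (x, t) powr q * V t powr (1 - q)) \<partial>lborel) \<partial>lborel)
      = (\<integral>\<^sup>+t. (\<integral>\<^sup>+x. ennreal (\<Psi> (x, t) powr q * V t powr (1 - q)) \<partial>lborel) \<partial>lborel)"
    by (rule lborel_pair.Fubini'[symmetric]) measurable
  also have "\<dots> \<le> (\<integral>\<^sup>+t. ennreal (indicator {c..d} t * V t) \<partial>lborel)"
  proof (rule nn_integral_mono)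
    fix t
    show "(\<integral>\<^sup>+x. ennreal (\<Psi> (x, t) powr q * V t powr (1 - q)) \<partial>lborel) \<le> ennreal (indicator {c..d} t * V t)"
    proof (cases "t \<in> {c..d}")
      case True
      let ?N = "integral {a..b} (\<lambda>x. F x t powr q)"
      have contFq: "continuous_on {a..b} (\<lambda>x. F x t powr q)"
        using cont_t[OF True] nn[OF _ True] q by (intro continuous_on_powr' continuous_intros) auto
      have N0: "0 \<le> ?N" by (intro integral_nonneg integrable_continuous_real contFq) simp
      have "?N = (?N powr (1 / q)) powr q" using N0 q by (simp add: powr_powr)
      also have "\<dots> \<le> V t powr q"
        using le[OF True] \<epsilon> True q by (intro powr_mono2) (auto simp: V_def)
      finally have N: "?N \<le> V t powr q" .
      have "(\<integral>\<^sup>+x. ennreal (\<Psi> (x, t) powr q * V t powr (1 - q)) \<partial>lborel)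
          = (\<integral>\<^sup>+x. ennreal (V t powr (1 - q)) * ennreal (indicator {a..b} x * F x t powr q) \<partial>lborel)"
        by (rule nn_integral_cong) (use True q in \<open>auto simp: \<Psi>_def indicator_def ennreal_mult'[symmetric] mult.commute\<close>)
      also have "\<dots> = ennreal (V t powr (1 - q)) * (\<integral>\<^sup>+x. ennreal (indicator {a..b} x * F x t powr q) \<partial>lborel)"
        using borel_measurable_continuous_on_indicator[OF _ contFq] by (intro nn_integral_cmult) simp
      also have "\<dots> = ennreal (V t powr (1 - q)) * ennreal ?N"
        by (subst nn_integral_continuous_interval[OF contFq]) auto
      also have "\<dots> \<le> ennreal (V t powr (1 - q)) * ennreal (V t powr q)"
        by (intro mult_left_mono ennreal_leI N) auto
      also have "\<dots> = ennreal (V t)"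
        using V0[of t] by (simp add: ennreal_mult'[symmetric] powr_add[symmetric])
      finally show ?thesis using True by simp
    qed (use q in \<open>simp add: \<Psi>_def\<close>)
  qed
  also have "\<dots> = ennreal I" by (rule I)
  also have "ennreal (I powr (q - 1)) * ennreal I = ennreal (I powr q)"
    using I0 by (simp add: ennreal_mult'[symmetric] powr_diff)
  finally have "integral {a..b} (\<lambda>x. S x powr q) \<le> I powr q"
    by (simp add: mult_left_mono)
  then have "integral {a..b} (\<lambda>x. S x powr q) powr (1 / q) \<le> (I powr q) powr (1 / q)"
    using q by (intro powr_mono2 integral_nonneg integrable_continuous_real contSq) auto
  also have "\<dots> = I" using I0 q by (simp add: powr_powr)
  finally show ?thesis by (simp add: S_def I_def)
qed

lemma circle_norm_integral:
  fixes c d :: real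
  assumes p: "1 \<le> p" and cd: "c < d"
    and F: "continuous_on ({0..2 * pi} \<times> {c..d}) (\<lambda>(x, t). F x t)"
    and W: "set_integrable lborel {c..d} W"
    and le: "\<And>t. t \<in> {c..d} \<Longrightarrow> circle_norm p (\<lambda>x. F x t) \<le> W t"
  shows "circle_norm p (\<lambda>x. integral {c..d} (F x)) \<le> (LINT t:{c..d}|lborel. W t)"
proof -
  have absF: "continuous_on ({0..2 * pi} \<times> {c..d}) (\<lambda>(x, t). \<bar>F x t\<bar>)"
    using continuous_on_rabs[OF F] by (simp add: split_beta)
  note cont_x = continuous_on_section(1)[OF F] and cont_t = continuous_on_section(2)[OF F]
  have abs_le: "\<bar>integral {c..d} (F x)\<bar> \<le> integral {c..d} (\<lambda>t. \<bar>F x t\<bar>)" if "x \<in> {0..2 * pi}" for x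
    using integral_norm_bound_integral[of "F x" "{c..d}" "\<lambda>t. \<bar>F x t\<bar>"]
      integrable_continuous_real[OF cont_x[OF that]] integrable_continuous_real[OF continuous_on_rabs[OF cont_x[OF that]]]
    by simp
  have contI: "continuous_on {0..2 * pi} (\<lambda>x. integral {c..d} (F x))"
    "continuous_on {0..2 * pi} (\<lambda>x. integral {c..d} (\<lambda>t. \<bar>F x t\<bar>))"
    using integral_continuous_on_param[of "{0..2 * pi}" c d F] F
      integral_continuous_on_param[of "{0..2 * pi}" c d "\<lambda>x t. \<bar>F x t\<bar>"] absF by simp_all
  show ?thesis
  proof (cases "p = \<infinity>")
    case True
    have si: "set_integrable lborel {c..d} (\<lambda>t. \<bar>F 0 t\<bar>)"
      using cont_x[of 0] by (intro borel_integrable_atLeastAtMost' continuous_intros) auto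
    have "circle_norm p (\<lambda>x. integral {c..d} (F x)) \<le> integral {c..d} (\<lambda>t. \<bar>F 0 t\<bar>)"
      using abs_le[of 0] True by (simp add: circle_norm_def)
    also have "\<dots> = (LINT t:{c..d}|lborel. \<bar>F 0 t\<bar>)"
      using set_borel_integral_eq_integral(2)[OF si] by simp
    also have "\<dots> \<le> (LINT t:{c..d}|lborel. W t)"
      using le True by (intro set_integral_mono si W) (simp add: circle_norm_def)
    finally show ?thesis .
  next
    case False
    let ?q = "enn2real p"
    have q: "1 \<le> ?q" using False p enn2real_ge_1 by blast
    have "circle_norm p (\<lambda>x. integral {c..d} (F x)) \<le> circle_norm p (\<lambda>x. integral {c..d} (\<lambda>t. \<bar>F x t\<bar>))"
      by (intro circle_norm_mono contI p) (use abs_le in force)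
    also have "\<dots> = integral {0..2 * pi} (\<lambda>x. integral {c..d} (\<lambda>t. \<bar>F x t\<bar>) powr ?q) powr (1 / ?q)"
    proof -
      have "integral {0..2 * pi} (\<lambda>x. \<bar>integral {c..d} (\<lambda>t. \<bar>F x t\<bar>)\<bar> powr ?q)
          = integral {0..2 * pi} (\<lambda>x. integral {c..d} (\<lambda>t. \<bar>F x t\<bar>) powr ?q)"
        by (rule integral_cong) (use abs_le in force)
      then show ?thesis using circle_norm_finite[OF contI(2) p False] by simp
    qed
    also have "\<dots> \<le> (LINT t:{c..d}|lborel. W t)"
    proof (rule field_le_epsilon)
      fix e :: real assume "0 < e"
      then have e: "0 < e / (d - c)" using cd by simp
      have "integral {0..2 * pi} (\<lambda>x. integral {c..d} (\<lambda>t. \<bar>F x t\<bar>) powr ?q) powr (1 / ?q)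
        \<le> (LINT t:{c..d}|lborel. W t) + e / (d - c) * (d - c)"
        by (rule minkowski_integral[OF q cd e absF _ W]) (use le cont_t in \<open>auto simp: circle_norm_finite[OF _ p False]\<close>)
      then show "integral {0..2 * pi} (\<lambda>x. integral {c..d} (\<lambda>t. \<bar>F x t\<bar>) powr ?q) powr (1 / ?q)
        \<le> (LINT t:{c..d}|lborel. W t) + e" using cd by simp
    qed
    finally show ?thesis .
  qed
qed

section \<open>Weights and the boundary kernel\<close>

lemma weight_classD:
  assumes "\<phi> \<in> weight_class"
  shows "\<phi> 0 = 0" "\<And>t. 0 \<le> t \<Longrightarrow> 0 \<le> \<phi> t" "\<And>s t. \<lbrakk>0 \<le> s; s \<le> t\<rbrakk> \<Longrightarrow> \<phi> s \<le> \<phi> t"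
  using assms by (auto simp: weight_class_def mono_on_def)

text \<open>
  A concave function vanishing at \<open>0\<close> has decreasing slopes of chords from the origin.
\<close>

lemma weight_ratio_antimono:
  assumes \<phi>: "\<phi> \<in> weight_class" and st: "0 < s" "s \<le> t"
  shows "\<phi> t / t \<le> \<phi> s / s"
proof -
  have "(1 - s / t) * \<phi> 0 + (s / t) * \<phi> t \<le> \<phi> ((1 - s / t) *\<^sub>R 0 + (s / t) *\<^sub>R t)"
    by (rule concave_onD[of "{0..}"]) (use \<phi> st in \<open>auto simp: weight_class_def\<close>)
  then show ?thesis
    using st weight_classD(1)[OF \<phi>] by (simp add: field_simps)
qed

lemma weight_pos:
  assumes \<phi>: "\<phi> \<in> weight_class" and t: "0 < t"
  shows "0 < \<phi> t"
proof -
  obtain s where s: "0 \<le> s" "\<phi> s \<noteq> 0" using \<phi> by (auto simp: weight_class_def)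
  then have s0: "0 < s" "0 < \<phi> s"
    using weight_classD[OF \<phi>] by (metis le_less)+
  show ?thesis
  proof (cases "s \<le> t")
    case True
    then show ?thesis using s0 weight_classD(3)[OF \<phi>, of s t] by linarith
  next
    case False
    then have "0 < \<phi> s / s" "\<phi> s / s \<le> \<phi> t / t"
      using s0 t weight_ratio_antimono[OF \<phi>, of t s] by auto
    then have "0 < \<phi> t / t" by linarith
    then show ?thesis using t by (simp add: zero_less_divide_iff)
  qed
qed

text \<open>
  A weight is constrained only on \<open>[0, \<infinity>)\<close>; the truncation yields a monotone function on the
  whole line.
\<close>

lemma weight_borel_measurable:
  assumes "\<phi> \<in> weight_class"
  shows "(\<lambda>t. \<phi> (max 0 t)) \<in> borel_measurable borel"
  by (rule borel_measurable_mono) (auto simp: mono_def intro!: weight_classD(3)[OF assms])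

lemma set_integrable_bounded_interval:
  fixes h k :: "real \<Rightarrow> real"
  assumes k: "k \<in> borel_measurable borel" and eq: "\<And>t. t \<in> {a..b} \<Longrightarrow> h t = k t"
    and b: "\<And>t. t \<in> {a..b} \<Longrightarrow> \<bar>k t\<bar> \<le> B"
  shows "set_integrable lborel {a..b} h"
proof -
  have "integrable lborel (\<lambda>t. indicator {a..b} t * k t)"
  proof (rule Bochner_Integration.integrable_bound)
    show "integrable lborel (\<lambda>t. indicator {a..b} t * B)"
      using borel_integrable_atLeastAtMost'[of a b "\<lambda>_. B"] by (simp add: set_integrable_def)
    show "AE t in lborel. norm (indicator {a..b} t * k t) \<le> norm (indicator {a..b} t * B)"
    proof (rule AE_I2)
      fix t show "norm (indicator {a..b} t * k t) \<le> norm (indicator {a..b} t * B)"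
        using b[of t] by (cases "t \<in> {a..b}") auto
    qed
  qed (use k in simp)
  moreover have "indicator {a..b} t * k t = indicator {a..b} t *\<^sub>R h t" for t
    using eq by (simp add: indicator_def)
  ultimately show ?thesis by (simp add: set_integrable_def)
qed

text \<open>
  The tail condition is exactly what bounds the kernel. For \<open>|s - pi| \<le> \<delta>\<close> the integrand is at most
  \<open>\<phi> \<delta> / \<delta>\<^sup>2\<close> on a set of length \<open>2 \<delta>\<close>; beyond that it is \<open>\<phi> t / t\<^sup>2\<close> with
  \<open>t = |s - pi|\<close>. The two halves of the interval are reflections of each other.
\<close>

lemma weight_kernel_integral:
  assumes \<phi>: "\<phi> \<in> weight_class" and \<delta>: "0 < \<delta>" "\<delta> \<le> pi"
    and tail: "\<delta> * (LINT t:{\<delta>..pi}|lborel. \<phi> t / t\<^sup>2) \<le> C * \<phi> \<delta>"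
  shows "set_integrable lborel {0..2 * pi} (\<lambda>s. \<phi> \<bar>s - pi\<bar> / (max \<delta> \<bar>s - pi\<bar>)\<^sup>2)"
    and "(LINT s:{0..2 * pi}|lborel. \<phi> \<bar>s - pi\<bar> / (max \<delta> \<bar>s - pi\<bar>)\<^sup>2) \<le> 2 * (1 + C) * (\<phi> \<delta> / \<delta>)"
proof -
  define \<psi> where "\<psi> t = \<phi> (max 0 t)" for t
  have [measurable]: "\<psi> \<in> borel_measurable borel"
    using weight_borel_measurable[OF \<phi>] by (simp add: \<psi>_def[abs_def])
  have \<psi>: "\<psi> t = \<phi> t" if "0 \<le> t" for t using that by (simp add: \<psi>_def)
  have \<psi>0: "0 \<le> \<psi> t" for t by (simp add: \<psi>_def weight_classD[OF \<phi>])
  have \<psi>mono: "\<psi> s \<le> \<psi> t" if "s \<le> t" for s t using that by (auto simp: \<psi>_def intro!: weight_classD(3)[OF \<phi>])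
  define k where "k t = \<psi> t / (max \<delta> t)\<^sup>2" for t
  have [measurable]: "k \<in> borel_measurable borel" by (simp add: k_def[abs_def])
  have k0: "0 \<le> k t" for t by (simp add: k_def \<psi>0)
  have kb: "\<bar>k t\<bar> \<le> \<psi> pi / \<delta>\<^sup>2" if "t \<le> pi" for t
  proof -
    have "\<bar>k t\<bar> = k t" using k0[of t] by simp
    also have "\<dots> \<le> \<psi> pi / \<delta>\<^sup>2"
      using that \<delta> unfolding k_def by (intro frac_le \<psi>mono \<psi>0 power_mono) auto
    finally show ?thesis .
  qed
  have eq: "\<phi> \<bar>s - pi\<bar> / (max \<delta> \<bar>s - pi\<bar>)\<^sup>2 = k \<bar>s - pi\<bar>" for s
    by (simp add: k_def \<psi>)
  show si: "set_integrable lborel {0..2 * pi} (\<lambda>s. \<phi> \<bar>s - pi\<bar> / (max \<delta> \<bar>s - pi\<bar>)\<^sup>2)"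
    by (rule set_integrable_bounded_interval[where k = "\<lambda>s. k \<bar>s - pi\<bar>" and B = "\<psi> pi / \<delta>\<^sup>2"])
      (auto simp: eq intro!: kb)
  define h where "h t = indicator {0..pi} t * k t" for t :: real
  have h0: "0 \<le> h t" for t using k0 by (simp add: h_def)
  have ih: "integrable lborel h"
    using set_integrable_bounded_interval[of k 0 pi k "\<psi> pi / \<delta>\<^sup>2"] kb
    by (simp add: set_integrable_def h_def[abs_def])
  have ih': "integrable lborel (\<lambda>s. h (- pi + 1 * s))" "integrable lborel (\<lambda>s. h (pi + (-1) * s))"
    by (rule lborel_integrable_real_affine[OF ih]; simp)+
  have "(LINT s:{0..2 * pi}|lborel. \<phi> \<bar>s - pi\<bar> / (max \<delta> \<bar>s - pi\<bar>)\<^sup>2)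
      \<le> (LINT s|lborel. h (- pi + 1 * s) + h (pi + (-1) * s))"
    unfolding set_lebesgue_integral_def
  proof (rule integral_mono)
    fix s :: real
    show "indicator {0..2 * pi} s *\<^sub>R (\<phi> \<bar>s - pi\<bar> / (max \<delta> \<bar>s - pi\<bar>)\<^sup>2) \<le> h (- pi + 1 * s) + h (pi + (-1) * s)"
      unfolding eq using h0[of "s - pi"] h0[of "pi - s"]
      by (cases "s \<le> pi") (auto simp: h_def indicator_def abs_if)
  qed (use si ih' in \<open>auto simp: set_integrable_def\<close>)
  also have "\<dots> = (LINT s|lborel. h (- pi + 1 * s)) + (LINT s|lborel. h (pi + (-1) * s))"
    by (rule Bochner_Integration.integral_add[OF ih'])
  also have "\<dots> = 2 * (LINT t|lborel. h t)"
    using lborel_integral_real_affine[of 1 h "- pi"] lborel_integral_real_affine[of "-1" h pi] by simp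
  also have "(LINT t|lborel. h t) \<le> (1 + C) * (\<phi> \<delta> / \<delta>)"
  proof -
    have i1: "set_integrable lborel {0..\<delta>} (\<lambda>t. \<phi> \<delta> / \<delta>\<^sup>2)"
      by (intro borel_integrable_atLeastAtMost' continuous_intros) (use \<delta> in auto)
    have i2: "set_integrable lborel {\<delta>..pi} (\<lambda>t. \<phi> t / t\<^sup>2)"
    proof (rule set_integrable_bounded_interval)
      show "(\<lambda>t. \<psi> t / t\<^sup>2) \<in> borel_measurable borel" by measurable
      show "\<phi> t / t\<^sup>2 = \<psi> t / t\<^sup>2" if "t \<in> {\<delta>..pi}" for t using that \<delta> by (simp add: \<psi>)
      show "\<bar>\<psi> t / t\<^sup>2\<bar> \<le> \<psi> pi / \<delta>\<^sup>2" if "t \<in> {\<delta>..pi}" for t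
        using that \<delta> \<psi>0[of t] by (auto intro!: frac_le \<psi>mono \<psi>0 power_mono)
    qed
    have "(LINT t|lborel. h t) \<le> (LINT t|lborel. indicator {0..\<delta>} t *\<^sub>R (\<phi> \<delta> / \<delta>\<^sup>2) + indicator {\<delta>..pi} t *\<^sub>R (\<phi> t / t\<^sup>2))"
    proof (rule integral_mono)
      fix t
      show "h t \<le> indicator {0..\<delta>} t *\<^sub>R (\<phi> \<delta> / \<delta>\<^sup>2) + indicator {\<delta>..pi} t *\<^sub>R (\<phi> t / t\<^sup>2)"
      proof (cases "t \<in> {0..pi}")
        case True
        show ?thesis
        proof (cases "t \<le> \<delta>")
          case t: True
          have "h t \<le> \<phi> \<delta> / \<delta>\<^sup>2"
            using True t \<delta> \<psi>mono[OF t] by (simp add: h_def k_def \<psi> divide_right_mono)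
          moreover have "0 \<le> indicator {\<delta>..pi} t *\<^sub>R (\<phi> t / t\<^sup>2)"
            using True weight_classD(2)[OF \<phi>] by simp
          ultimately show ?thesis using True t by simp
        next
          case False
          then show ?thesis using True \<delta> by (simp add: h_def k_def \<psi> max_def)
        qed
      next
        case False
        then have "h t = 0" by (simp add: h_def)
        moreover have "0 \<le> indicator {0..\<delta>} t *\<^sub>R (\<phi> \<delta> / \<delta>\<^sup>2)"
          using \<delta> weight_classD(2)[OF \<phi>, of \<delta>] by simp
        moreover have "0 \<le> indicator {\<delta>..pi} t *\<^sub>R (\<phi> t / t\<^sup>2)"
          using \<delta> weight_classD(2)[OF \<phi>, of t] by (cases "t \<in> {\<delta>..pi}") simp_all
        ultimately show ?thesis by simp
      qed
    qed (use ih i1 i2 in \<open>auto simp: set_integrable_def\<close>)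
    also have "\<dots> = (LINT t:{0..\<delta>}|lborel. \<phi> \<delta> / \<delta>\<^sup>2) + (LINT t:{\<delta>..pi}|lborel. \<phi> t / t\<^sup>2)"
      unfolding set_lebesgue_integral_def
      by (rule Bochner_Integration.integral_add) (use i1 i2 in \<open>auto simp: set_integrable_def\<close>)
    also have "(LINT t:{0..\<delta>}|lborel. \<phi> \<delta> / \<delta>\<^sup>2) = \<phi> \<delta> / \<delta>"
      using \<delta> by (simp add: set_lebesgue_integral_def power2_eq_square)
    also have "(LINT t:{\<delta>..pi}|lborel. \<phi> t / t\<^sup>2) \<le> C * (\<phi> \<delta> / \<delta>)"
      using tail \<delta> by (simp add: field_simps)
    finally show ?thesis by (simp add: distrib_right add_divide_distrib)
  qed
  finally show "(LINT s:{0..2 * pi}|lborel. \<phi> \<bar>s - pi\<bar> / (max \<delta> \<bar>s - pi\<bar>)\<^sup>2) \<le> 2 * (1 + C) * (\<phi> \<delta> / \<delta>)"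
    by (simp only: mult.assoc)
qed

lemma cmod_cis_minus_one_le: "cmod (cis t - 1) \<le> \<bar>t\<bar>"
proof -
  have "cmod (cis t - 1) = 2 * \<bar>sin (t / 2)\<bar>"
    using dist_exp_i_1[of t] by (simp add: cis_conv_exp)
  also have "\<dots> \<le> \<bar>t\<bar>" using abs_sin_x_le_abs_x[of "t / 2"] by simp
  finally show ?thesis .
qed

text \<open>
  Jordan's inequality for the sine, from its concavity on \<open>[0, pi / 2]\<close>.
\<close>

lemma cmod_cis_minus_one_ge:
  assumes "\<bar>t\<bar> \<le> pi"
  shows "2 * \<bar>t\<bar> / pi \<le> cmod (cis t - 1)"
proof -
  define x where "x = \<bar>t\<bar> / 2"
  have x: "0 \<le> x" "x \<le> pi / 2" using assms by (auto simp: x_def)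
  \<comment> \<open>The chord of the concave sine from \<open>0\<close> to \<open>pi / 2\<close> has slope \<open>2 / pi\<close>.\<close>
  have "concave_on {0..pi / 2} sin"
    by (rule f''_le0_imp_concave[where f' = cos and f'' = "\<lambda>x. - sin x"])
      (auto intro!: derivative_eq_intros sin_ge_zero)
  then have "(1 - x / (pi / 2)) * sin 0 + (x / (pi / 2)) * sin (pi / 2)
      \<le> sin ((1 - x / (pi / 2)) *\<^sub>R 0 + (x / (pi / 2)) *\<^sub>R (pi / 2))"
    by (rule concave_onD) (use x in \<open>auto simp: field_simps\<close>)
  then have "2 * x / pi \<le> sin x" by (simp add: field_simps)
  moreover have "sin x = \<bar>sin (t / 2)\<bar>"
    using x sin_ge_zero[of x] by (cases "0 \<le> t") (auto simp: x_def abs_if)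
  ultimately have "2 * \<bar>t\<bar> / pi \<le> 2 * \<bar>sin (t / 2)\<bar>"
    by (simp add: x_def)
  also have "\<dots> = cmod (cis t - 1)"
    using dist_exp_i_1[of t] by (simp add: cis_conv_exp)
  finally show ?thesis .
qed

text \<open>
  The kernel \<open>1 / |cis t - r|\<^sup>2\<close> is at most a multiple of \<open>1 / (max (1 - r) |t|)\<^sup>2\<close>, the
  kernel of the weight estimate. The part with \<open>|t|\<close> is the triangle inequality through \<open>1\<close>.
\<close>

lemma cmod_cis_minus_real_ge:
  assumes t: "\<bar>t\<bar> \<le> pi" and r: "0 \<le> r" "r < 1"
  shows "max (1 - r) \<bar>t\<bar> / pi \<le> cmod (cis t - of_real r)"
proof -
  have 1: "1 - r \<le> cmod (cis t - of_real r)"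
    using norm_triangle_ineq2[of "cis t" "of_real r"] r by simp
  have "cmod (cis t - 1) \<le> cmod (cis t - of_real r) + cmod (of_real r - 1)"
    using norm_triangle_ineq[of "cis t - of_real r" "of_real r - 1"] by simp
  also have "cmod (of_real r - 1) = 1 - r"
    using r by (metis abs_minus_commute abs_of_nonneg diff_ge_0_iff_ge less_imp_le norm_of_real of_real_1 of_real_diff)
  finally have "\<bar>t\<bar> / pi \<le> cmod (cis t - of_real r)"
    using 1 cmod_cis_minus_one_ge[OF t] by simp
  moreover have "(1 - r) / pi \<le> 1 - r"
    using r pi_ge_two by (simp add: divide_le_eq mult_le_cancel_left1)
  ultimately show ?thesis using 1 by (auto simp: max_def)
qed

section \<open>Quasiregularity and the gradient of the real part\<close>

text \<open>
  The set on which the inequality fails is open, hence of positive measure unless it is empty.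
\<close>

lemma AE_le_imp_le_on_open:
  fixes F G :: "complex \<Rightarrow> real"
  assumes S: "open S" and cont: "continuous_on S F" "continuous_on S G"
    and ae: "AE z in lebesgue_on S. F z \<le> G z" and z: "z \<in> S"
  shows "F z \<le> G z"
proof (rule ccontr)
  assume "\<not> F z \<le> G z"
  define U where "U = {w \<in> S. G w < F w}"
  have "open U"
    using open_Collect_less_Int[OF cont(2,1)] S unfolding U_def by (metis open_Int)
  moreover have "z \<in> U" using z \<open>\<not> F z \<le> G z\<close> by (simp add: U_def)
  ultimately obtain a b where ab: "cbox a b \<subseteq> U" "z \<in> box a b"
    by (rule open_contains_cbox)
  have "AE w in lebesgue. w \<in> S \<longrightarrow> F w \<le> G w"
    using ae S by (subst (asm) AE_restrict_space_iff) auto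
  then obtain N where "N \<in> null_sets lebesgue" "{w. \<not> (w \<in> S \<longrightarrow> F w \<le> G w)} \<subseteq> N"
    unfolding eventually_ae_filter by auto
  then have "negligible U"
    by (auto simp: negligible_iff_null_sets[symmetric] U_def not_le elim!: negligible_subset)
  then have "negligible (cbox a b)" using ab negligible_subset by blast
  then show False using ab by (auto simp: negligible_interval)
qed

lemma C1_on_continuous:
  assumes "C1_on S f"
  shows "continuous_on S (d_z f)" "continuous_on S (d_zbar f)" "continuous_on S (Lam f)" "continuous_on S (Jac f)"
proof -
  show dz: "continuous_on S (d_z f)" "continuous_on S (d_zbar f)"
    using assms unfolding C1_on_def d_z_def[abs_def] d_zbar_def[abs_def] by (auto intro!: continuous_intros)
  show "continuous_on S (Lam f)" "continuous_on S (Jac f)"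
    unfolding Lam_def[abs_def] Jac_def[abs_def] by (intro continuous_intros dz)+
qed

text \<open>
  The number \<open>d_z f + cnj (d_zbar f)\<close> is twice the \<open>z\<close>-derivative of \<open>Re f\<close>, that is, the complex
  gradient of the real part of \<open>f\<close>.
\<close>

lemma gradient_le_Lam: "cmod (d_z f z + cnj (d_zbar f z)) \<le> Lam f z"
  using norm_triangle_ineq[of "d_z f z" "cnj (d_zbar f z)"] by (simp add: Lam_def)

text \<open>
  With \<open>a = d_z f\<close> and \<open>b = cnj (d_zbar f)\<close> the Jacobian is \<open>Re ((a + b) cnj (a - b))\<close>: the product
  of the gradients of the real and the imaginary part.
\<close>

lemma Jac_le_gradient_Lam: "Jac f z \<le> cmod (d_z f z + cnj (d_zbar f z)) * Lam f z"
proof -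
  define a b where "a = d_z f z" and "b = cnj (d_zbar f z)"
  have "Jac f z = Re ((a + b) * cnj (a - b))"
    unfolding Jac_def cmod_power2 by (simp add: a_def b_def power2_eq_square algebra_simps)
  also have "\<dots> \<le> cmod (a + b) * cmod (a - b)"
    by (metis complex_Re_le_cmod complex_mod_cnj norm_mult)
  also have "\<dots> \<le> cmod (a + b) * Lam f z"
    using norm_triangle_ineq4[of a b] by (intro mult_left_mono) (simp_all add: Lam_def a_def b_def)
  finally show ?thesis by (simp add: a_def b_def)
qed

text \<open>
  Quasiregularity transfers control from the real part to all of \<open>f\<close>. It gives
  \<open>\<Lambda>\<^sup>2 \<le> K g \<Lambda> + K\<^sub>0\<close> with \<open>g\<close> the gradient of \<open>Re f\<close>, and \<open>\<Lambda> > K g + sqrt K\<^sub>0\<close> would force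
  \<open>\<Lambda> (\<Lambda> - K g) > K\<^sub>0\<close>. By continuity the almost everywhere hypothesis holds at every point.
\<close>

lemma quasiregular_Lam_le:
  assumes qr: "quasiregular_on S K K0 f" and C1: "C1_on S f" and S: "open S" "z \<in> S" and K: "0 \<le> K" "0 \<le> K0"
  shows "Lam f z \<le> K * cmod (d_z f z + cnj (d_zbar f z)) + sqrt K0"
proof (rule ccontr)
  let ?g = "cmod (d_z f z + cnj (d_zbar f z))"
  assume "\<not> ?thesis"
  then have 1: "sqrt K0 < Lam f z - K * ?g" by simp
  have "(Lam f z)\<^sup>2 \<le> K * Jac f z + K0"
  proof (rule AE_le_imp_le_on_open[OF S(1) _ _ _ S(2)])
    show "AE z in lebesgue_on S. (Lam f z)\<^sup>2 \<le> K * Jac f z + K0"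
      using qr by (simp add: quasiregular_on_def)
  qed (intro continuous_intros C1_on_continuous[OF C1])+
  also have "\<dots> \<le> K * (?g * Lam f z) + K0"
    using K Jac_le_gradient_Lam[of f z] by (simp add: mult_left_mono)
  finally have "Lam f z * (Lam f z - K * ?g) \<le> K0"
    by (simp add: power2_eq_square algebra_simps)
  moreover have "0 \<le> K * ?g" using K by simp
  then have 2: "sqrt K0 < Lam f z" using 1 by linarith
  have "sqrt K0 * sqrt K0 < Lam f z * (Lam f z - K * ?g)"
    by (rule mult_strict_mono') (use 1 2 K in auto)
  ultimately show False using K by simp
qed

lemma harmonic_mapping_Re:
  assumes "harmonic_mapping_on (ball 0 1) f"
  shows "\<exists>G. G holomorphic_on ball 0 1 \<and> (\<forall>z\<in>ball 0 1. Re (G z) = Re (f z) \<and>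
    deriv G z = d_z f z + cnj (d_zbar f z))"
proof -
  have C2: "C2_on (ball 0 1) f" and lap: "\<And>z. z \<in> ball 0 1 \<Longrightarrow> laplacian (\<lambda>w. Re (f w)) z = 0"
    using assms by (auto simp: harmonic_mapping_on_def)
  have C1: "C1_on (ball 0 1) f" using C2 by (simp add: C2_on_def)
  obtain G where G: "\<And>z. z \<in> ball 0 1 \<Longrightarrow> (G has_field_derivative
      Complex (partial_x (\<lambda>w. Re (f w)) z) (- partial_y (\<lambda>w. Re (f w)) z)) (at z) \<and> Re (G z) = Re (f z)"
    using harmonic_imp_Re_holomorphic[OF C2_on_Re[OF C2 open_ball] lap open_ball convex_ball] by blast
  show ?thesis
  proof (intro exI conjI ballI)
    show "G holomorphic_on ball 0 1"
      using G by (subst holomorphic_on_open) blast+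
    fix z :: complex assume z: "z \<in> ball 0 1"
    show "Re (G z) = Re (f z)" using G[OF z] by simp
    have "deriv G z = Complex (partial_x (\<lambda>w. Re (f w)) z) (- partial_y (\<lambda>w. Re (f w)) z)"
      using G[OF z] DERIV_imp_deriv by blast
    also have "\<dots> = d_z f z + cnj (d_zbar f z)"
      unfolding C1_on_Re(2,3)[OF C1 z] by (simp add: d_z_def d_zbar_def complex_eq_iff field_simps)
    finally show "deriv G z = d_z f z + cnj (d_zbar f z)" .
  qed
qed

section \<open>From the boundary modulus to the growth of the derivative\<close>

lemma continuous_on_rotation:
  assumes "continuous_on S h" "\<And>\<theta>. z * cis \<theta> \<in> S"
  shows "continuous_on A (\<lambda>\<theta>. h (z * cis \<theta>))"
  by (rule continuous_on_compose2[OF assms(1)]) (use assms(2) in \<open>auto intro!: continuous_intros\<close>)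

lemma continuous_on_deriv:
  assumes "G holomorphic_on S" "open S"
  shows "continuous_on S (deriv G)"
  using holomorphic_deriv[OF assms] holomorphic_on_imp_continuous_on by blast

text \<open>
  The pointwise bound of \<open>G'\<close> by oscillations of \<open>u\<close> is averaged over rotations. Minkowski's
  inequality moves the norm inside, where the oscillation at angular distance \<open>t = |s - pi|\<close> becomes
  a modulus of continuity, at most \<open>M \<phi> t\<close> because chords are shorter than arcs. What remains is
  the weight kernel.
\<close>

lemma circle_norm_deriv_le:
  fixes u :: "complex \<Rightarrow> real"
  assumes \<phi>: "\<phi> \<in> weight_class" and p: "1 \<le> p" and C: "0 \<le> C" and M: "0 \<le> M"
    and tail: "\<And>\<delta>. \<lbrakk>0 < \<delta>; \<delta> \<le> pi\<rbrakk> \<Longrightarrow> \<delta> * (LINT t:{\<delta>..pi}|lborel. \<phi> t / t\<^sup>2) \<le> C * \<phi> \<delta>"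
    and G: "G holomorphic_on ball 0 1" and u: "continuous_on (cball 0 1) u"
    and Gu: "\<And>w. w \<in> ball 0 1 \<Longrightarrow> Re (G w) = u w"
    and bound: "Lphi_bound \<phi> p M u" and z: "z \<in> ball 0 1"
  shows "circle_norm p (\<lambda>\<theta>. cmod (deriv G (z * cis \<theta>))) \<le> 2 * pi * (1 + C) * M * (\<phi> (1 - cmod z) / (1 - cmod z))"
proof -
  define r where "r = cmod z"
  \<comment> \<open>At the origin every boundary point is nearest.\<close>
  define \<zeta> where "\<zeta> = (if z = 0 then 1 else sgn z)"
  have r: "0 \<le> r" "r < 1" and \<zeta>: "cmod \<zeta> = 1" and z_eq: "z = of_real r * \<zeta>"
    using z norm_sgn[of z] by (simp_all add: r_def \<zeta>_def) (simp_all add: sgn_div_norm scaleR_conv_of_real)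
  have \<delta>: "0 < 1 - r" "1 - r \<le> pi" using r pi_ge_two by auto
  define D where "D s = (cmod (cis (s - pi) - of_real r))\<^sup>2" for s
  define F where "F \<theta> s = \<bar>u (cis (s - pi) * (\<zeta> * cis \<theta>)) - u (\<zeta> * cis \<theta>)\<bar> / D s" for \<theta> s
  have D0: "0 < D s" for s
  proof -
    have "cis (s - pi) \<noteq> of_real r"
      using r norm_cis[of "s - pi"] by (metis abs_of_nonneg less_irrefl norm_of_real)
    then show ?thesis by (simp add: D_def)
  qed
  have contF: "continuous_on A (\<lambda>(\<theta>, s). F \<theta> s)" for A
  proof -
    have "continuous_on A (\<lambda>x. u (cis (snd x - pi) * (\<zeta> * cis (fst x))))"
      by (rule continuous_on_compose2[OF u]) (use \<zeta> in \<open>auto intro!: continuous_intros simp: norm_mult\<close>)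
    moreover have "continuous_on A (\<lambda>x. u (\<zeta> * cis (fst x)))"
      by (rule continuous_on_compose2[OF u]) (use \<zeta> in \<open>auto intro!: continuous_intros simp: norm_mult\<close>)
    moreover have "continuous_on A (\<lambda>x. D (snd x))"
      unfolding D_def by (intro continuous_intros)
    ultimately show ?thesis
      unfolding F_def split_beta by (intro continuous_intros) (use D0 in \<open>auto simp: less_imp_neq[symmetric]\<close>)
  qed
  have contI: "continuous_on {0..2 * pi} (\<lambda>\<theta>. integral {0..2 * pi} (F \<theta>))"
    using integral_continuous_on_param[of "{0..2 * pi}" 0 "2 * pi" F] contF by simp
  have "circle_norm p (\<lambda>\<theta>. cmod (deriv G (z * cis \<theta>))) \<le> circle_norm p (\<lambda>\<theta>. (1 / pi) * integral {0..2 * pi} (F \<theta>))"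
  proof (rule circle_norm_mono)
    show "continuous_on {0..2 * pi} (\<lambda>\<theta>. cmod (deriv G (z * cis \<theta>)))"
      by (intro continuous_on_norm continuous_on_rotation[OF continuous_on_deriv[OF G open_ball]]) (use z in \<open>simp add: norm_mult\<close>)
    fix \<theta>
    have "pi * cmod (deriv G (of_real r * (\<zeta> * cis \<theta>))) \<le> integral {0..2 * pi} (F \<theta>)"
      unfolding F_def D_def by (rule deriv_bound_boundary_oscillation[OF G u Gu r]) (use \<zeta> in \<open>auto simp: norm_mult\<close>)
    then have "cmod (deriv G (z * cis \<theta>)) \<le> (1 / pi) * integral {0..2 * pi} (F \<theta>)"
      by (simp add: z_eq field_simps)
    then show "\<bar>cmod (deriv G (z * cis \<theta>))\<bar> \<le> \<bar>(1 / pi) * integral {0..2 * pi} (F \<theta>)\<bar>"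
      unfolding abs_norm_cancel by (rule order_trans[OF _ abs_ge_self])
  qed (intro continuous_intros contI p)+
  also have "\<dots> = (1 / pi) * circle_norm p (\<lambda>\<theta>. integral {0..2 * pi} (F \<theta>))"
    by (subst circle_norm_mult[OF p]) simp
  finally have 1: "circle_norm p (\<lambda>\<theta>. cmod (deriv G (z * cis \<theta>)))
      \<le> (1 / pi) * circle_norm p (\<lambda>\<theta>. integral {0..2 * pi} (F \<theta>))" .
  have "circle_norm p (\<lambda>\<theta>. integral {0..2 * pi} (F \<theta>))
      \<le> (LINT s:{0..2 * pi}|lborel. (M * pi\<^sup>2) * (\<phi> \<bar>s - pi\<bar> / (max (1 - r) \<bar>s - pi\<bar>)\<^sup>2))"
  proof (rule circle_norm_integral[OF p _ contF])
    show "set_integrable lborel {0..2 * pi} (\<lambda>s. (M * pi\<^sup>2) * (\<phi> \<bar>s - pi\<bar> / (max (1 - r) \<bar>s - pi\<bar>)\<^sup>2))"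
      by (intro set_integrable_mult_right weight_kernel_integral(1)[OF \<phi> \<delta> tail[OF \<delta>]])
    fix s assume "s \<in> {0..2 * pi}"
    then have s: "\<bar>s - pi\<bar> \<le> pi" by auto
    have "circle_norm p (\<lambda>\<theta>. F \<theta> s) = circle_norm p (\<lambda>\<theta>. (1 / D s) * \<bar>u (cis \<theta> * (cis (s - pi) * \<zeta>)) - u (cis \<theta> * \<zeta>)\<bar>)"
      by (simp add: F_def mult_ac)
    also have "\<dots> = (1 / D s) * circle_norm p (\<lambda>\<theta>. \<bar>u (cis \<theta> * (cis (s - pi) * \<zeta>)) - u (cis \<theta> * \<zeta>)\<bar>)"
      using D0[of s] by (subst circle_norm_mult[OF p]) simp
    also have "\<dots> = (1 / D s) * Lp_modulus p u (cis (s - pi) * \<zeta>) \<zeta>"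
      by (simp add: Lp_modulus_eq_circle_norm circle_norm_def)
    also have "\<dots> \<le> (1 / D s) * (M * \<phi> (cmod (cis (s - pi) * \<zeta> - \<zeta>)))"
      using bound \<zeta> D0[of s] by (intro mult_left_mono) (auto simp: Lphi_bound_def norm_mult)
    also have "cmod (cis (s - pi) * \<zeta> - \<zeta>) = cmod (cis (s - pi) - 1)"
      using \<zeta> by (metis left_diff_distrib mult.left_neutral mult.right_neutral norm_mult)
    also have "(1 / D s) * (M * \<phi> (cmod (cis (s - pi) - 1))) \<le> (pi\<^sup>2 / (max (1 - r) \<bar>s - pi\<bar>)\<^sup>2) * (M * \<phi> \<bar>s - pi\<bar>)"
    proof (intro mult_mono mult_left_mono)
      show "\<phi> (cmod (cis (s - pi) - 1)) \<le> \<phi> \<bar>s - pi\<bar>"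
        by (rule weight_classD(3)[OF \<phi>]) (auto simp: cmod_cis_minus_one_le)
      have m: "0 < max (1 - r) \<bar>s - pi\<bar>" using r by simp
      have "(max (1 - r) \<bar>s - pi\<bar> / pi)\<^sup>2 \<le> D s"
        unfolding D_def by (intro power_mono cmod_cis_minus_real_ge[OF s r]) (use m in simp)
      then have "1 / D s \<le> 1 / (max (1 - r) \<bar>s - pi\<bar> / pi)\<^sup>2"
        using m by (intro divide_left_mono mult_pos_pos D0) auto
      then show "1 / D s \<le> pi\<^sup>2 / (max (1 - r) \<bar>s - pi\<bar>)\<^sup>2"
        by (simp add: power_divide)
    qed (use M D0[of s] weight_classD(2)[OF \<phi>] in auto)
    finally show "circle_norm p (\<lambda>\<theta>. F \<theta> s) \<le> (M * pi\<^sup>2) * (\<phi> \<bar>s - pi\<bar> / (max (1 - r) \<bar>s - pi\<bar>)\<^sup>2)"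
      by (simp add: field_simps)
  qed simp
  also have "\<dots> = (M * pi\<^sup>2) * (LINT s:{0..2 * pi}|lborel. \<phi> \<bar>s - pi\<bar> / (max (1 - r) \<bar>s - pi\<bar>)\<^sup>2)"
    by (rule set_integral_mult_right)
  also have "\<dots> \<le> (M * pi\<^sup>2) * (2 * (1 + C) * (\<phi> (1 - r) / (1 - r)))"
    using M by (intro mult_left_mono weight_kernel_integral(2)[OF \<phi> \<delta> tail[OF \<delta>]]) auto
  finally have "(1 / pi) * circle_norm p (\<lambda>\<theta>. integral {0..2 * pi} (F \<theta>))
      \<le> (1 / pi) * ((M * pi\<^sup>2) * (2 * (1 + C) * (\<phi> (1 - r) / (1 - r))))"
    by (rule mult_left_mono) simp
  also have "\<dots> = 2 * pi * (1 + C) * M * (\<phi> (1 - r) / (1 - r))"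
    by (simp add: power2_eq_square)
  finally show ?thesis using 1 unfolding r_def by (rule order_trans[rotated])
qed

text \<open>
  The regularity of \<open>Re f\<close> bounds its gradient, and quasiregularity passes the bound to \<open>\<Lambda>\<^sub>f\<close>. The
  constant \<open>8 pi\<close> in front of \<open>sqrt K0\<close> is the quasi-triangle constant \<open>4\<close> times the bound
  \<open>2 pi\<close> for the norm of the constant function \<open>1\<close>.
\<close>

lemma Lam_growth_of_Lphi_bound:
  assumes \<phi>: "\<phi> \<in> weight_class" and C: "0 \<le> C"
    and tail: "\<And>\<delta>. \<lbrakk>0 < \<delta>; \<delta> \<le> pi\<rbrakk> \<Longrightarrow> \<delta> * (LINT t:{\<delta>..pi}|lborel. \<phi> t / t\<^sup>2) \<le> C * \<phi> \<delta>"
    and K: "1 \<le> K" "0 \<le> K0" and p: "1 \<le> p"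
    and f: "harmonic_mapping_on (ball 0 1) f" "quasiregular_on (ball 0 1) K K0 f" "continuous_on (cball 0 1) f"
    and M: "0 \<le> M" and bound: "Lphi_bound \<phi> p M (\<lambda>\<xi>. Re (f \<xi>))"
  shows "Lam_growth \<phi> p K0 f (8 * pi * (1 + C) * K * M) (8 * pi)"
  unfolding Lam_growth_def
proof
  fix z :: complex assume z: "z \<in> ball 0 1"
  have C1: "C1_on (ball 0 1) f" using f(1) by (simp add: harmonic_mapping_on_def C2_on_def)
  obtain G where G: "G holomorphic_on ball 0 1" and Gu: "\<And>w. w \<in> ball 0 1 \<Longrightarrow> Re (G w) = Re (f w)"
    and dG: "\<And>w. w \<in> ball 0 1 \<Longrightarrow> deriv G w = d_z f w + cnj (d_zbar f w)"
    using harmonic_mapping_Re[OF f(1)] by blast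
  have u: "continuous_on (cball 0 1) (\<lambda>w. Re (f w))" by (intro continuous_intros f(3))
  have rot: "z * cis \<theta> \<in> ball 0 1" for \<theta> using z by (simp add: norm_mult)
  have cont: "continuous_on {0..2 * pi} (\<lambda>\<theta>. cmod (deriv G (z * cis \<theta>)))"
    by (intro continuous_on_norm continuous_on_rotation[OF continuous_on_deriv[OF G open_ball]] rot)
  have "Lam_mean p f z = circle_norm p (\<lambda>\<theta>. Lam f (z * cis \<theta>))"
    by (rule Lam_mean_eq_circle_norm)
  also have "\<dots> \<le> circle_norm p (\<lambda>\<theta>. K * cmod (deriv G (z * cis \<theta>)) + sqrt K0)"
  proof (rule circle_norm_mono[OF _ _ p])
    show "continuous_on {0..2 * pi} (\<lambda>\<theta>. Lam f (z * cis \<theta>))"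
      by (rule continuous_on_rotation[OF C1_on_continuous(3)[OF C1] rot])
    fix \<theta>
    have "0 \<le> Lam f (z * cis \<theta>)" by (simp add: Lam_def)
    moreover have "Lam f (z * cis \<theta>) \<le> K * cmod (deriv G (z * cis \<theta>)) + sqrt K0"
      unfolding dG[OF rot] by (rule quasiregular_Lam_le[OF f(2) C1 open_ball rot]) (use K in auto)
    ultimately show "\<bar>Lam f (z * cis \<theta>)\<bar> \<le> \<bar>K * cmod (deriv G (z * cis \<theta>)) + sqrt K0\<bar>" by simp
  qed (intro continuous_intros cont)
  also have "\<dots> \<le> 4 * (circle_norm p (\<lambda>\<theta>. K * cmod (deriv G (z * cis \<theta>))) + circle_norm p (\<lambda>\<theta>. sqrt K0))"
    by (rule circle_norm_add[OF _ _ p]) (intro continuous_intros cont)+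
  also have "circle_norm p (\<lambda>\<theta>. K * cmod (deriv G (z * cis \<theta>))) = K * circle_norm p (\<lambda>\<theta>. cmod (deriv G (z * cis \<theta>)))"
    using K by (subst circle_norm_mult[OF p]) simp
  also have "4 * (\<dots> + circle_norm p (\<lambda>\<theta>. sqrt K0))
    \<le> 4 * (K * (2 * pi * (1 + C) * M * (\<phi> (1 - cmod z) / (1 - cmod z))) + 2 * pi * sqrt K0)"
    by (intro mult_left_mono add_mono circle_norm_deriv_le[OF \<phi> p C M tail G u Gu bound z] circle_norm_bound[OF _ p])
      (use K in auto)
  finally show "Lam_mean p f z \<le> 8 * pi * (1 + C) * K * M * (\<phi> (1 - cmod z) / (1 - cmod z)) + 8 * pi * sqrt K0"
    by (simp add: algebra_simps)
qed

section \<open>From the growth of the derivative to the boundary modulus\<close>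

text \<open>
  The fundamental theorem of calculus along a segment, for all rotations of the segment at once.
\<close>

lemma circle_norm_increment_le:
  fixes u :: "complex \<Rightarrow> real"
  assumes p: "1 \<le> p" and G: "G holomorphic_on ball 0 1" and Gu: "\<And>w. w \<in> ball 0 1 \<Longrightarrow> Re (G w) = u w"
    and cd: "c < d" and path: "\<And>t. t \<in> {c..d} \<Longrightarrow> a + of_real t * v \<in> ball 0 1"
    and W: "set_integrable lborel {c..d} W"
    and le: "\<And>t. t \<in> {c..d} \<Longrightarrow> circle_norm p (\<lambda>\<theta>. cmod (deriv G ((a + of_real t * v) * cis \<theta>))) \<le> W t"
  shows "circle_norm p (\<lambda>\<theta>. u ((a + of_real d * v) * cis \<theta>) - u ((a + of_real c * v) * cis \<theta>))
    \<le> cmod v * (LINT t:{c..d}|lborel. W t)"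
proof -
  define \<gamma> where "\<gamma> \<theta> t = (a + of_real t * v) * cis \<theta>" for \<theta> t
  have \<gamma>: "\<gamma> \<theta> t \<in> ball 0 1" if "t \<in> {c..d}" for \<theta> t
    using path[OF that] by (simp add: \<gamma>_def norm_mult)
  define F where "F \<theta> t = Re (deriv G (\<gamma> \<theta> t) * (v * cis \<theta>))" for \<theta> t
  have contF: "continuous_on (A \<times> {c..d}) (\<lambda>(\<theta>, t). F \<theta> t)" for A
  proof -
    have "continuous_on (A \<times> {c..d}) (\<lambda>x. deriv G (\<gamma> (fst x) (snd x)))"
      by (rule continuous_on_compose2[OF continuous_on_deriv[OF G open_ball]])
        (use \<gamma> in \<open>auto simp: \<gamma>_def intro!: continuous_intros\<close>)
    then show ?thesis unfolding F_def split_beta by (intro continuous_intros)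
  qed
  have FTC: "integral {c..d} (F \<theta>) = u ((a + of_real d * v) * cis \<theta>) - u ((a + of_real c * v) * cis \<theta>)" for \<theta>
  proof -
    have "((\<lambda>t. Re (G (\<gamma> \<theta> t))) has_vector_derivative F \<theta> t) (at t within {c..d})" if t: "t \<in> {c..d}" for t
    proof -
      have "(G has_field_derivative deriv G (\<gamma> \<theta> t)) (at (\<gamma> \<theta> t))"
        by (rule holomorphic_derivI[OF G open_ball \<gamma>[OF t]])
      moreover have "(\<gamma> \<theta> has_vector_derivative v * cis \<theta>) (at t within {c..d})"
        unfolding \<gamma>_def has_vector_derivative_def
        by (auto intro!: derivative_eq_intros simp: scaleR_conv_of_real)
      ultimately have "((G \<circ> \<gamma> \<theta>) has_vector_derivative (v * cis \<theta>) * deriv G (\<gamma> \<theta> t)) (at t within {c..d})"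
        using field_vector_diff_chain_within has_field_derivative_at_within by blast
      from bounded_linear.has_vector_derivative[OF bounded_linear_Re this] show ?thesis
        unfolding F_def o_def by (simp only: mult.commute[of "v * cis \<theta>"])
    qed
    then have "(F \<theta> has_integral Re (G (\<gamma> \<theta> d)) - Re (G (\<gamma> \<theta> c))) {c..d}"
      using cd by (intro fundamental_theorem_of_calculus) auto
    then show ?thesis
      using Gu[OF \<gamma>] cd by (simp add: integral_unique \<gamma>_def)
  qed
  have "circle_norm p (\<lambda>\<theta>. integral {c..d} (F \<theta>)) \<le> (LINT t:{c..d}|lborel. cmod v * W t)"
  proof (rule circle_norm_integral[OF p cd contF])
    show "set_integrable lborel {c..d} (\<lambda>t. cmod v * W t)"
      by (intro set_integrable_mult_right W)
    fix t assume t: "t \<in> {c..d}"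
    have cd: "continuous_on {0..2 * pi} (\<lambda>\<theta>. cmod (deriv G ((a + of_real t * v) * cis \<theta>)))"
      by (intro continuous_on_norm continuous_on_rotation[OF continuous_on_deriv[OF G open_ball]])
        (use path[OF t] in \<open>simp add: norm_mult\<close>)
    have "circle_norm p (\<lambda>\<theta>. F \<theta> t) \<le> circle_norm p (\<lambda>\<theta>. cmod v * cmod (deriv G ((a + of_real t * v) * cis \<theta>)))"
    proof (rule circle_norm_mono[OF _ _ p])
      show "continuous_on {0..2 * pi} (\<lambda>\<theta>. F \<theta> t)"
        by (rule continuous_on_section(2)[OF contF t])
      show "continuous_on {0..2 * pi} (\<lambda>\<theta>. cmod v * cmod (deriv G ((a + of_real t * v) * cis \<theta>)))"
        by (intro continuous_intros cd)
      fix \<theta>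
      show "\<bar>F \<theta> t\<bar> \<le> \<bar>cmod v * cmod (deriv G ((a + of_real t * v) * cis \<theta>))\<bar>"
        using abs_Re_le_cmod[of "deriv G (\<gamma> \<theta> t) * (v * cis \<theta>)"]
        by (simp add: F_def \<gamma>_def norm_mult mult.commute)
    qed
    also have "\<dots> \<le> cmod v * W t"
      using le[OF t] by (subst circle_norm_mult[OF p]) (simp add: mult_left_mono)
    finally show "circle_norm p (\<lambda>\<theta>. F \<theta> t) \<le> cmod v * W t" .
  qed
  then show ?thesis by (simp add: FTC)
qed

text \<open>
  On the radius the growth condition integrates to the Dini integral. The segment is parametrised by
  the distance \<open>t\<close> to the circle and stopped at a small distance \<open>c\<close>, since \<open>G\<close> need not extend to
  the circle; the remaining piece is small by uniform continuity of \<open>u\<close>.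
\<close>

lemma circle_norm_radial_increment_le:
  fixes u :: "complex \<Rightarrow> real"
  assumes \<phi>: "\<phi> \<in> weight_class" and p: "1 \<le> p" and G: "G holomorphic_on ball 0 1"
    and Gu: "\<And>w. w \<in> ball 0 1 \<Longrightarrow> Re (G w) = u w" and u: "continuous_on (cball 0 1) u"
    and A: "0 \<le> A" and growth: "\<And>z. z \<in> ball 0 1 \<Longrightarrow>
      circle_norm p (\<lambda>\<theta>. cmod (deriv G (z * cis \<theta>))) \<le> A * (\<phi> (1 - cmod z) / (1 - cmod z))"
    and s: "0 < s" "s < 1" and C: "0 \<le> C"
    and dini: "(\<integral>\<^sup>+ t \<in> {0<..s}. ennreal (\<phi> t / t) \<partial>lborel) \<le> ennreal (C * \<phi> s)"
    and \<xi>: "cmod \<xi> = 1"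
  shows "circle_norm p (\<lambda>\<theta>. u (\<xi> * cis \<theta>) - u (of_real (1 - s) * \<xi> * cis \<theta>)) \<le> 4 * A * C * \<phi> s"
proof (rule field_le_epsilon)
  fix e :: real assume e: "0 < e"
  \<comment> \<open>The quasi-triangle inequality and the bound for a uniformly small function cost \<open>4 * (2 * pi)\<close>.\<close>
  define e' where "e' = e / (8 * pi)"
  have e': "0 < e'" using e by (simp add: e'_def)
  have "uniformly_continuous_on (cball 0 1) u"
    by (rule compact_uniformly_continuous[OF u compact_cball])
  then obtain \<eta> where \<eta>: "0 < \<eta>"
    "\<And>x y. \<lbrakk>x \<in> cball 0 1; y \<in> cball 0 1; dist y x < \<eta>\<rbrakk> \<Longrightarrow> dist (u y) (u x) < e'"
    unfolding uniformly_continuous_on_def using e' by meson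
  define c where "c = min (\<eta> / 2) (s / 2)"
  have c: "0 < c" "c < s" "c < \<eta>" using \<eta> s by (auto simp: c_def)
  have cont: "continuous_on {0..2 * pi} (\<lambda>\<theta>. u (w * cis \<theta>))" if "cmod w \<le> 1" for w
    by (rule continuous_on_rotation[OF u]) (use that in \<open>simp add: norm_mult\<close>)
  have int: "set_integrable lborel {c..s} (\<lambda>t. \<phi> t / t)"
  proof (rule set_integrable_bounded_interval)
    show "(\<lambda>t. \<phi> (max 0 t) / t) \<in> borel_measurable borel"
      using weight_borel_measurable[OF \<phi>] by measurable
    show "\<phi> t / t = \<phi> (max 0 t) / t" if "t \<in> {c..s}" for t using that c by simp
    show "\<bar>\<phi> (max 0 t) / t\<bar> \<le> \<phi> s / c" if "t \<in> {c..s}" for t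
      using that c weight_classD(2)[OF \<phi>, of t] weight_classD(3)[OF \<phi>, of t s]
      by (auto intro!: frac_le)
  qed
  have LINT_le: "(LINT t:{c..s}|lborel. \<phi> t / t) \<le> C * \<phi> s"
  proof -
    have "ennreal (LINT t:{c..s}|lborel. \<phi> t / t) = (\<integral>\<^sup>+ t. ennreal (indicator {c..s} t *\<^sub>R (\<phi> t / t)) \<partial>lborel)"
      unfolding set_lebesgue_integral_def
      by (rule nn_integral_eq_integral[symmetric])
        (use int c weight_classD(2)[OF \<phi>] in \<open>auto simp: set_integrable_def indicator_def\<close>)
    also have "\<dots> \<le> (\<integral>\<^sup>+ t \<in> {0<..s}. ennreal (\<phi> t / t) \<partial>lborel)"
      by (rule nn_integral_mono) (use c in \<open>auto simp: indicator_def\<close>)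
    also have "\<dots> \<le> ennreal (C * \<phi> s)" by (rule dini)
    finally show ?thesis
      using C weight_classD(2)[OF \<phi>, of s] s by (subst (asm) ennreal_le_iff) auto
  qed
  have pt: "\<xi> + of_real t * - \<xi> = of_real (1 - t) * \<xi>" for t by (simp add: algebra_simps)
  have npt: "cmod (of_real (1 - t) * \<xi>) = 1 - t" if "t \<le> 1" for t
    using that \<xi> unfolding norm_mult norm_of_real by simp
  have "circle_norm p (\<lambda>\<theta>. u ((\<xi> + of_real s * - \<xi>) * cis \<theta>) - u ((\<xi> + of_real c * - \<xi>) * cis \<theta>))
      \<le> cmod (- \<xi>) * (LINT t:{c..s}|lborel. A * (\<phi> t / t))"
  proof (rule circle_norm_increment_le[OF p G Gu c(2)])
    show "set_integrable lborel {c..s} (\<lambda>t. A * (\<phi> t / t))"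
      by (intro set_integrable_mult_right int)
    fix t assume t: "t \<in> {c..s}"
    then have nt: "cmod (of_real (1 - t) * \<xi>) = 1 - t" using npt s by auto
    show "\<xi> + of_real t * - \<xi> \<in> ball 0 1"
      unfolding pt using nt t c by (simp del: of_real_diff)
    then show "circle_norm p (\<lambda>\<theta>. cmod (deriv G ((\<xi> + of_real t * - \<xi>) * cis \<theta>))) \<le> A * (\<phi> t / t)"
      using growth[of "\<xi> + of_real t * - \<xi>"] unfolding pt nt by simp
  qed
  also have "\<dots> = A * (LINT t:{c..s}|lborel. \<phi> t / t)"
    using \<xi> by (simp only: norm_minus_cancel set_integral_mult_right mult_1)
  also have "\<dots> \<le> A * (C * \<phi> s)" using LINT_le A by (rule mult_left_mono)
  finally have 1: "circle_norm p (\<lambda>\<theta>. u (of_real (1 - s) * \<xi> * cis \<theta>) - u (of_real (1 - c) * \<xi> * cis \<theta>)) \<le> A * (C * \<phi> s)"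
    unfolding pt .
  have sym: "circle_norm p (\<lambda>\<theta>. u (of_real (1 - c) * \<xi> * cis \<theta>) - u (of_real (1 - s) * \<xi> * cis \<theta>))
    = circle_norm p (\<lambda>\<theta>. u (of_real (1 - s) * \<xi> * cis \<theta>) - u (of_real (1 - c) * \<xi> * cis \<theta>))"
    by (simp add: circle_norm_def abs_minus_commute)
  have conts: "continuous_on {0..2 * pi} (\<lambda>\<theta>. u (\<xi> * cis \<theta>))"
    "continuous_on {0..2 * pi} (\<lambda>\<theta>. u (of_real (1 - c) * \<xi> * cis \<theta>))"
    "continuous_on {0..2 * pi} (\<lambda>\<theta>. u (of_real (1 - s) * \<xi> * cis \<theta>))"
    using c s \<xi> npt[of c] npt[of s] by (intro cont; simp)+
  have 2: "circle_norm p (\<lambda>\<theta>. u (\<xi> * cis \<theta>) - u (of_real (1 - c) * \<xi> * cis \<theta>)) \<le> 2 * pi * e'"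
  proof (rule circle_norm_bound[OF _ p])
    fix \<theta>
    have "dist (\<xi> * cis \<theta>) (of_real (1 - c) * \<xi> * cis \<theta>) = cmod (of_real c * (\<xi> * cis \<theta>))"
      unfolding dist_norm by (rule arg_cong[where f = cmod]) (simp add: algebra_simps)
    also have "\<dots> < \<eta>" using c \<xi> by (simp add: norm_mult)
    finally have "dist (u (\<xi> * cis \<theta>)) (u (of_real (1 - c) * \<xi> * cis \<theta>)) < e'"
      using \<xi> npt[of c] c s by (intro \<eta>(2)) (auto simp: norm_mult)
    then show "\<bar>u (\<xi> * cis \<theta>) - u (of_real (1 - c) * \<xi> * cis \<theta>)\<bar> \<le> e'"
      by (simp add: dist_real_def)
  qed (intro continuous_intros conts)
  have "circle_norm p (\<lambda>\<theta>. u (\<xi> * cis \<theta>) - u (of_real (1 - s) * \<xi> * cis \<theta>))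
    = circle_norm p (\<lambda>\<theta>. (u (\<xi> * cis \<theta>) - u (of_real (1 - c) * \<xi> * cis \<theta>))
        + (u (of_real (1 - c) * \<xi> * cis \<theta>) - u (of_real (1 - s) * \<xi> * cis \<theta>)))"
    by simp
  also have "\<dots> \<le> 4 * (circle_norm p (\<lambda>\<theta>. u (\<xi> * cis \<theta>) - u (of_real (1 - c) * \<xi> * cis \<theta>))
      + circle_norm p (\<lambda>\<theta>. u (of_real (1 - c) * \<xi> * cis \<theta>) - u (of_real (1 - s) * \<xi> * cis \<theta>)))"
    by (rule circle_norm_add[OF _ _ p]) (intro continuous_intros conts)+
  also have "\<dots> \<le> 4 * (2 * pi * e' + A * (C * \<phi> s))"
    using 1 2 unfolding sym by simp
  also have "\<dots> = 4 * A * C * \<phi> s + e" by (simp add: e'_def)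
  finally show "circle_norm p (\<lambda>\<theta>. u (\<xi> * cis \<theta>) - u (of_real (1 - s) * \<xi> * cis \<theta>)) \<le> 4 * A * C * \<phi> s + e" .
qed

text \<open>
  A chord of length at most \<open>s\<close> at distance at least \<open>s\<close> from the circle. There the gradient is
  at most \<open>A \<phi> s / s\<close> because \<open>\<phi> t / t\<close> decreases.
\<close>

lemma circle_norm_tangential_increment_le:
  fixes u :: "complex \<Rightarrow> real"
  assumes \<phi>: "\<phi> \<in> weight_class" and p: "1 \<le> p" and G: "G holomorphic_on ball 0 1"
    and Gu: "\<And>w. w \<in> ball 0 1 \<Longrightarrow> Re (G w) = u w"
    and A: "0 \<le> A" and growth: "\<And>z. z \<in> ball 0 1 \<Longrightarrow>
      circle_norm p (\<lambda>\<theta>. cmod (deriv G (z * cis \<theta>))) \<le> A * (\<phi> (1 - cmod z) / (1 - cmod z))"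
    and s: "0 < s" "s < 1" and ab: "cmod a \<le> 1 - s" "cmod b \<le> 1 - s" "cmod (b - a) \<le> s"
  shows "circle_norm p (\<lambda>\<theta>. u (b * cis \<theta>) - u (a * cis \<theta>)) \<le> A * \<phi> s"
proof -
  have "circle_norm p (\<lambda>\<theta>. u ((a + of_real 1 * (b - a)) * cis \<theta>) - u ((a + of_real 0 * (b - a)) * cis \<theta>))
      \<le> cmod (b - a) * (LINT t:{0..1::real}|lborel. A * (\<phi> s / s))"
  proof (rule circle_norm_increment_le[OF p G Gu])
    fix t :: real assume t: "t \<in> {0..1}"
    have "a + of_real t * (b - a) = (1 - t) *\<^sub>R a + t *\<^sub>R b"
      by (simp add: scaleR_conv_of_real algebra_simps)
    moreover have "\<dots> \<in> cball 0 (1 - s)"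
      by (rule convexD[OF convex_cball]) (use t ab in auto)
    ultimately have n: "cmod (a + of_real t * (b - a)) \<le> 1 - s" by simp
    then show b: "a + of_real t * (b - a) \<in> ball 0 1" using s by simp
    have "circle_norm p (\<lambda>\<theta>. cmod (deriv G ((a + of_real t * (b - a)) * cis \<theta>)))
        \<le> A * (\<phi> (1 - cmod (a + of_real t * (b - a))) / (1 - cmod (a + of_real t * (b - a))))"
      by (rule growth[OF b])
    also have "\<dots> \<le> A * (\<phi> s / s)"
      using n s by (intro mult_left_mono A weight_ratio_antimono[OF \<phi>]) auto
    finally show "circle_norm p (\<lambda>\<theta>. cmod (deriv G ((a + of_real t * (b - a)) * cis \<theta>))) \<le> A * (\<phi> s / s)" .
  qed (auto intro!: borel_integrable_atLeastAtMost' continuous_intros)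
  also have "\<dots> = cmod (b - a) * (A * (\<phi> s / s))"
    by (simp add: set_lebesgue_integral_def)
  also have "\<dots> \<le> s * (A * (\<phi> s / s))"
    using A s ab weight_classD(2)[OF \<phi>, of s] by (intro mult_right_mono) auto
  also have "\<dots> = A * \<phi> s" using s by simp
  finally show ?thesis by simp
qed

lemma continuous_imp_Lp_circle:
  assumes u: "continuous_on (sphere 0 1) u" and p: "1 \<le> p"
  shows "u \<in> Lp_circle p"
proof -
  have cont: "continuous_on {0..2 * pi} (\<lambda>\<eta>. u (cis \<eta>))"
    using continuous_on_rotation[OF u, of 1] by simp
  have "(\<lambda>\<eta>. u (cis \<eta>)) \<in> borel_measurable (lebesgue_on {0..2 * pi})"
    using continuous_imp_integrable_real[OF cont] by (rule borel_measurable_integrable)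
  moreover have "\<exists>B. AE \<eta> in lebesgue_on {0..2 * pi}. \<bar>u (cis \<eta>)\<bar> \<le> B"
  proof -
    have "bounded (u ` sphere 0 1)"
      by (intro compact_imp_bounded compact_continuous_image u) simp
    then obtain B where "\<forall>x\<in>u ` sphere 0 1. norm x \<le> B"
      unfolding bounded_iff by blast
    then have "\<bar>u (cis \<eta>)\<bar> \<le> B" for \<eta> by simp
    then show ?thesis by (intro exI[of _ B] AE_I2)
  qed
  moreover have "integrable (lebesgue_on {0..2 * pi}) (\<lambda>\<eta>. \<bar>u (cis \<eta>)\<bar> powr enn2real p)" if "p \<noteq> \<infinity>"
    by (intro continuous_imp_integrable_real continuous_on_abs_powr cont enn2real_ge_1 p that)
  ultimately show ?thesis by (simp add: Lp_circle_def)
qed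

text \<open>
  Two boundary points at distance \<open>s\<close> are joined by going radially inwards to depth \<open>s\<close>, across, and
  back to the circle.
\<close>

lemma Lphi_bound_small_arcs:
  fixes u :: "complex \<Rightarrow> real"
  assumes \<phi>: "\<phi> \<in> weight_class" and p: "1 \<le> p" and G: "G holomorphic_on ball 0 1"
    and Gu: "\<And>w. w \<in> ball 0 1 \<Longrightarrow> Re (G w) = u w" and u: "continuous_on (cball 0 1) u"
    and A: "0 \<le> A" and growth: "\<And>z. z \<in> ball 0 1 \<Longrightarrow>
      circle_norm p (\<lambda>\<theta>. cmod (deriv G (z * cis \<theta>))) \<le> A * (\<phi> (1 - cmod z) / (1 - cmod z))"
    and C: "0 \<le> C" and \<xi>: "cmod \<xi>1 = 1" "cmod \<xi>2 = 1" and s: "0 < cmod (\<xi>1 - \<xi>2)" "cmod (\<xi>1 - \<xi>2) < 1"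
    and dini: "(\<integral>\<^sup>+ t \<in> {0<..cmod (\<xi>1 - \<xi>2)}. ennreal (\<phi> t / t) \<partial>lborel) \<le> ennreal (C * \<phi> (cmod (\<xi>1 - \<xi>2)))"
  shows "circle_norm p (\<lambda>\<theta>. u (\<xi>1 * cis \<theta>) - u (\<xi>2 * cis \<theta>)) \<le> (16 + 80 * C) * A * \<phi> (cmod (\<xi>1 - \<xi>2))"
proof -
  define s where "s = cmod (\<xi>1 - \<xi>2)"
  note s = s[folded s_def] and dini = dini[folded s_def]
  let ?r = "of_real (1 - s) :: complex"
  have ns: "cmod ?r = 1 - s" using s unfolding norm_of_real by simp
  have cont: "continuous_on {0..2 * pi} (\<lambda>\<theta>. u (w * cis \<theta>))" if "cmod w \<le> 1" for w
    by (rule continuous_on_rotation[OF u]) (use that in \<open>simp add: norm_mult\<close>)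
  have n: "cmod (?r * \<xi>1) = 1 - s" "cmod (?r * \<xi>2) = 1 - s"
    using \<xi> ns by (simp_all only: norm_mult mult_1_right)
  have conts: "continuous_on {0..2 * pi} (\<lambda>\<theta>. u (\<xi>1 * cis \<theta>))" "continuous_on {0..2 * pi} (\<lambda>\<theta>. u (\<xi>2 * cis \<theta>))"
    "continuous_on {0..2 * pi} (\<lambda>\<theta>. u (?r * \<xi>1 * cis \<theta>))" "continuous_on {0..2 * pi} (\<lambda>\<theta>. u (?r * \<xi>2 * cis \<theta>))"
    using \<xi> n s by (intro cont; simp)+
  define a b c where "a \<theta> = u (\<xi>1 * cis \<theta>) - u (?r * \<xi>1 * cis \<theta>)"
    and "b \<theta> = u (?r * \<xi>1 * cis \<theta>) - u (?r * \<xi>2 * cis \<theta>)"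
    and "c \<theta> = u (?r * \<xi>2 * cis \<theta>) - u (\<xi>2 * cis \<theta>)" for \<theta>
  have abc: "continuous_on {0..2 * pi} a" "continuous_on {0..2 * pi} b" "continuous_on {0..2 * pi} c"
    unfolding a_def b_def c_def by (intro continuous_intros conts)+
  have 1: "circle_norm p a \<le> 4 * A * C * \<phi> s"
    unfolding a_def by (rule circle_norm_radial_increment_le[OF \<phi> p G Gu u A growth s C dini \<xi>(1)])
  have "circle_norm p c = circle_norm p (\<lambda>\<theta>. u (\<xi>2 * cis \<theta>) - u (?r * \<xi>2 * cis \<theta>))"
    by (simp add: c_def circle_norm_def abs_minus_commute)
  also have "\<dots> \<le> 4 * A * C * \<phi> s"
    by (rule circle_norm_radial_increment_le[OF \<phi> p G Gu u A growth s C dini \<xi>(2)])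
  finally have 3: "circle_norm p c \<le> 4 * A * C * \<phi> s" .
  have "cmod (?r * \<xi>1 - ?r * \<xi>2) = (1 - s) * s"
    unfolding right_diff_distrib[symmetric] norm_mult ns s_def[symmetric] ..
  also have "\<dots> \<le> 1 * s" using s by (intro mult_right_mono) auto
  finally have "cmod (?r * \<xi>1 - ?r * \<xi>2) \<le> s" by simp
  then have 2: "circle_norm p b \<le> A * \<phi> s"
    unfolding b_def using n by (intro circle_norm_tangential_increment_le[OF \<phi> p G Gu A growth s]) auto
  have "circle_norm p (\<lambda>\<theta>. u (\<xi>1 * cis \<theta>) - u (\<xi>2 * cis \<theta>)) = circle_norm p (\<lambda>\<theta>. a \<theta> + (b \<theta> + c \<theta>))"
    by (simp add: a_def b_def c_def)
  also have "\<dots> \<le> 4 * (circle_norm p a + circle_norm p (\<lambda>\<theta>. b \<theta> + c \<theta>))"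
    by (intro circle_norm_add p continuous_intros abc)
  also have "\<dots> \<le> 4 * (circle_norm p a + 4 * (circle_norm p b + circle_norm p c))"
    by (intro mult_left_mono add_left_mono circle_norm_add p abc) auto
  also have "\<dots> \<le> 4 * (4 * A * C * \<phi> s + 4 * (A * \<phi> s + 4 * A * C * \<phi> s))"
    using 1 2 3 by simp
  also have "\<dots> = (16 + 80 * C) * A * \<phi> s" by (simp add: algebra_simps)
  finally show ?thesis by (simp add: s_def)
qed

text \<open>
  Short distances are handled by the path through the disc. The Dini condition is available only
  below some \<open>\<delta>0\<close>, and beyond \<open>s0 < \<delta>0\<close> the oscillation is bounded by a multiple of the
  positive number \<open>\<phi> s0\<close>.
\<close>

lemma Lphi_of_Lam_growth:
  assumes dini: "dini_weight \<phi>" and p: "1 \<le> p" and K0: "0 \<le> K0"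
    and f: "harmonic_mapping_on (ball 0 1) f" "continuous_on (cball 0 1) f"
    and A: "0 < A" and B: "0 < B" and growth: "Lam_growth \<phi> p K0 f A B"
  shows "(\<lambda>\<xi>. Re (f \<xi>)) \<in> Lphi \<phi> p"
proof -
  define u where "u w = Re (f w)" for w
  have \<phi>: "\<phi> \<in> weight_class" using dini by (simp add: dini_weight_def)
  obtain \<delta>0 C where \<delta>0: "0 < \<delta>0" and C: "0 < C" and
    D: "\<And>\<delta>. \<lbrakk>0 < \<delta>; \<delta> < \<delta>0\<rbrakk> \<Longrightarrow> (\<integral>\<^sup>+ t \<in> {0<..\<delta>}. ennreal (\<phi> t / t) \<partial>lborel) \<le> ennreal (C * \<phi> \<delta>)"
    using dini unfolding dini_weight_def by blast
  have C1: "C1_on (ball 0 1) f" using f(1) by (simp add: harmonic_mapping_on_def C2_on_def)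
  obtain G where G: "G holomorphic_on ball 0 1" and Gu: "\<And>w. w \<in> ball 0 1 \<Longrightarrow> Re (G w) = u w"
    and dG: "\<And>w. w \<in> ball 0 1 \<Longrightarrow> deriv G w = d_z f w + cnj (d_zbar f w)"
    using harmonic_mapping_Re[OF f(1)] unfolding u_def by blast
  have u: "continuous_on (cball 0 1) u" unfolding u_def by (intro continuous_intros f(2))
  have us: "continuous_on (sphere 0 1) u" by (rule continuous_on_subset[OF u]) auto
  have \<phi>1: "0 < \<phi> 1" by (rule weight_pos[OF \<phi>]) simp
  \<comment> \<open>Since \<open>\<phi> \<delta> / \<delta> \<ge> \<phi> 1\<close> for \<open>\<delta> \<le> 1\<close>, the summand \<open>B * sqrt K0\<close> can be absorbed.\<close>
  define A' where "A' = A + B * sqrt K0 / \<phi> 1"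
  have A': "0 \<le> A'" using A B K0 \<phi>1 by (simp add: A'_def)
  have growth': "circle_norm p (\<lambda>\<theta>. cmod (deriv G (z * cis \<theta>))) \<le> A' * (\<phi> (1 - cmod z) / (1 - cmod z))"
    if z: "z \<in> ball 0 1" for z
  proof -
    have rot: "z * cis \<theta> \<in> ball 0 1" for \<theta> using z by (simp add: norm_mult)
    have "circle_norm p (\<lambda>\<theta>. cmod (deriv G (z * cis \<theta>))) \<le> circle_norm p (\<lambda>\<theta>. Lam f (z * cis \<theta>))"
    proof (rule circle_norm_mono[OF _ _ p])
      show "continuous_on {0..2 * pi} (\<lambda>\<theta>. cmod (deriv G (z * cis \<theta>)))"
        by (intro continuous_on_norm continuous_on_rotation[OF continuous_on_deriv[OF G open_ball]] rot)
      show "continuous_on {0..2 * pi} (\<lambda>\<theta>. Lam f (z * cis \<theta>))"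
        by (rule continuous_on_rotation[OF C1_on_continuous(3)[OF C1] rot])
      show "\<bar>cmod (deriv G (z * cis \<theta>))\<bar> \<le> \<bar>Lam f (z * cis \<theta>)\<bar>" for \<theta>
        unfolding dG[OF rot] using gradient_le_Lam[of f "z * cis \<theta>"] by simp
    qed
    also have "\<dots> \<le> A * (\<phi> (1 - cmod z) / (1 - cmod z)) + B * sqrt K0"
      using growth z unfolding Lam_growth_def Lam_mean_eq_circle_norm by blast
    also have "B * sqrt K0 = (B * sqrt K0 / \<phi> 1) * (\<phi> 1 / 1)" using \<phi>1 by simp
    also have "\<dots> \<le> (B * sqrt K0 / \<phi> 1) * (\<phi> (1 - cmod z) / (1 - cmod z))"
      using z B K0 \<phi>1 by (intro mult_left_mono weight_ratio_antimono[OF \<phi>]) auto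
    finally show ?thesis by (simp only: A'_def distrib_right)
  qed
  have "bounded (u ` sphere 0 1)"
    by (intro compact_imp_bounded compact_continuous_image us) simp
  then obtain b where "\<forall>x\<in>u ` sphere 0 1. norm x \<le> b"
    unfolding bounded_iff by blast
  then have b: "\<bar>u w\<bar> \<le> b" if "w \<in> sphere 0 1" for w using that by simp
  have b0: "0 \<le> b" using b[of 1] by simp
  define s0 where "s0 = min \<delta>0 1 / 2"
  have s0: "0 < s0" "s0 < 1" "s0 < \<delta>0" using \<delta>0 by (auto simp: s0_def min_def)
  have \<phi>s0: "0 < \<phi> s0" by (rule weight_pos[OF \<phi> s0(1)])
  \<comment> \<open>The summand \<open>1\<close> makes \<open>N\<close> positive even when \<open>u\<close> vanishes on the circle.\<close>
  define N where "N = 1 + (16 + 80 * C) * A' + 4 * pi * b / \<phi> s0"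
  have parts: "0 \<le> (16 + 80 * C) * A'" "0 \<le> 4 * pi * b / \<phi> s0"
    using C A' b0 \<phi>s0 by auto
  then have N: "0 < N" by (simp add: N_def)
  have "Lphi_bound \<phi> p N u"
    unfolding Lphi_bound_def
  proof (intro ballI)
    fix \<xi>1 \<xi>2 :: complex assume "\<xi>1 \<in> sphere 0 1" "\<xi>2 \<in> sphere 0 1"
    then have \<xi>: "cmod \<xi>1 = 1" "cmod \<xi>2 = 1" by auto
    define s where "s = cmod (\<xi>1 - \<xi>2)"
    have \<phi>s: "0 \<le> \<phi> s" by (rule weight_classD(2)[OF \<phi>]) (simp add: s_def)
    have cont: "continuous_on {0..2 * pi} (\<lambda>\<theta>. u (\<xi>1 * cis \<theta>) - u (\<xi>2 * cis \<theta>))"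
      by (intro continuous_intros continuous_on_rotation[OF us]) (use \<xi> in \<open>auto simp: norm_mult\<close>)
    have mod: "Lp_modulus p u \<xi>1 \<xi>2 = circle_norm p (\<lambda>\<theta>. u (\<xi>1 * cis \<theta>) - u (\<xi>2 * cis \<theta>))"
      by (simp add: Lp_modulus_eq_circle_norm mult.commute)
    consider "s = 0" | "0 < s" "s < s0" | "s0 \<le> s" using s_def norm_ge_zero[of "\<xi>1 - \<xi>2"] by linarith
    then have "Lp_modulus p u \<xi>1 \<xi>2 \<le> N * \<phi> s"
    proof cases
      case 1
      then have "circle_norm p (\<lambda>\<theta>. u (\<xi>1 * cis \<theta>) - u (\<xi>2 * cis \<theta>)) \<le> 2 * pi * 0"
        by (intro circle_norm_bound cont p) (simp add: s_def)
      then show ?thesis using 1 weight_classD(1)[OF \<phi>] by (simp add: mod)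
    next
      case 2
      have "Lp_modulus p u \<xi>1 \<xi>2 \<le> (16 + 80 * C) * A' * \<phi> s"
        unfolding mod s_def
        by (rule Lphi_bound_small_arcs[OF \<phi> p G Gu u A' growth' less_imp_le[OF C] \<xi>])
          (use 2 s0 in \<open>auto simp: s_def intro!: D\<close>)
      also have "\<dots> \<le> N * \<phi> s"
        using parts \<phi>s by (intro mult_right_mono) (auto simp: N_def)
      finally show ?thesis .
    next
      case 3
      have "Lp_modulus p u \<xi>1 \<xi>2 \<le> 2 * pi * (2 * b)"
        unfolding mod
      proof (rule circle_norm_bound[OF cont p])
        fix \<theta>
        have "\<bar>u (\<xi>1 * cis \<theta>)\<bar> \<le> b" "\<bar>u (\<xi>2 * cis \<theta>)\<bar> \<le> b"
          by (rule b, use \<xi> in \<open>simp add: norm_mult\<close>)+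
        then show "\<bar>u (\<xi>1 * cis \<theta>) - u (\<xi>2 * cis \<theta>)\<bar> \<le> 2 * b" by linarith
      qed
      also have "\<dots> = 4 * pi * b / \<phi> s0 * \<phi> s0" using \<phi>s0 by simp
      also have "\<dots> \<le> 4 * pi * b / \<phi> s0 * \<phi> s"
        using s0 3 parts by (intro mult_left_mono weight_classD(3)[OF \<phi>]) auto
      also have "\<dots> \<le> N * \<phi> s"
        using parts \<phi>s by (intro mult_right_mono) (auto simp: N_def)
      finally show ?thesis .
    qed
    then show "Lp_modulus p u \<xi>1 \<xi>2 \<le> N * \<phi> (cmod (\<xi>1 - \<xi>2))" by (simp add: s_def)
  qed
  then have "u \<in> Lphi \<phi> p"
    using continuous_imp_Lp_circle[OF us p] N by (auto simp: Lphi_def)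
  then show ?thesis by (simp add: u_def[abs_def])
qed

section \<open>The equivalence\<close>

theorem theorem2p3:
  shows "\<exists>C2 :: ennreal \<Rightarrow> real.
    (\<forall>p\<ge>1. 0 < C2 p) \<and>
    (\<forall>\<phi> :: real \<Rightarrow> real. dini_weight \<phi> \<longrightarrow> tail_condition \<phi> \<longrightarrow>
      (\<exists>C1 :: real \<Rightarrow> ennreal \<Rightarrow> real.
        (\<forall>K\<ge>1. \<forall>p\<ge>1. 0 < C1 K p) \<and>
        (\<forall>(K :: real) (K0 :: real) (p :: ennreal) (f :: complex \<Rightarrow> complex).
          1 \<le> K \<longrightarrow> 0 \<le> K0 \<longrightarrow> 1 \<le> p \<longrightarrow>
          harmonic_mapping_on (ball 0 1) f \<longrightarrow>
          quasiregular_on (ball 0 1) K K0 f \<longrightarrow>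
          continuous_on (cball 0 1) f \<longrightarrow>
            ((\<lambda>\<xi>. Re (f \<xi>)) \<in> Lphi \<phi> p \<longleftrightarrow>
              (\<exists>A>0. \<exists>B>0. Lam_growth \<phi> p K0 f A B)) \<and>
            (\<forall>M>0. Lphi_bound \<phi> p M (\<lambda>\<xi>. Re (f \<xi>)) \<longrightarrow>
              Lam_growth \<phi> p K0 f (C1 K p * M) (C2 p)))))"
proof (rule exI[of _ "\<lambda>_. 8 * pi"], intro conjI allI impI)
  fix \<phi> :: "real \<Rightarrow> real" assume dini: "dini_weight \<phi>" and tail: "tail_condition \<phi>"
  have \<phi>: "\<phi> \<in> weight_class" using dini by (simp add: dini_weight_def)
  obtain C where C: "0 < C" and
    tailC: "\<And>\<delta>. \<lbrakk>0 < \<delta>; \<delta> \<le> pi\<rbrakk> \<Longrightarrow> \<delta> * (LINT t:{\<delta>..pi}|lborel. \<phi> t / t\<^sup>2) \<le> C * \<phi> \<delta>"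
    using tail unfolding tail_condition_def by blast
  show "\<exists>C1 :: real \<Rightarrow> ennreal \<Rightarrow> real.
        (\<forall>K\<ge>1. \<forall>p\<ge>1. 0 < C1 K p) \<and>
        (\<forall>(K :: real) (K0 :: real) (p :: ennreal) (f :: complex \<Rightarrow> complex).
          1 \<le> K \<longrightarrow> 0 \<le> K0 \<longrightarrow> 1 \<le> p \<longrightarrow>
          harmonic_mapping_on (ball 0 1) f \<longrightarrow>
          quasiregular_on (ball 0 1) K K0 f \<longrightarrow>
          continuous_on (cball 0 1) f \<longrightarrow>
            ((\<lambda>\<xi>. Re (f \<xi>)) \<in> Lphi \<phi> p \<longleftrightarrow>
              (\<exists>A>0. \<exists>B>0. Lam_growth \<phi> p K0 f A B)) \<and>
            (\<forall>M>0. Lphi_bound \<phi> p M (\<lambda>\<xi>. Re (f \<xi>)) \<longrightarrow>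
              Lam_growth \<phi> p K0 f (C1 K p * M) (8 * pi)))"
  proof (rule exI[of _ "\<lambda>K _. 8 * pi * (1 + C) * K"], intro conjI allI impI)
    fix K K0 :: real and p :: ennreal and f :: "complex \<Rightarrow> complex"
    assume K: "1 \<le> K" "0 \<le> K0" and p: "1 \<le> p" and harm: "harmonic_mapping_on (ball 0 1) f"
      and qr: "quasiregular_on (ball 0 1) K K0 f" and cont: "continuous_on (cball 0 1) f"
    have quant: "Lam_growth \<phi> p K0 f (8 * pi * (1 + C) * K * M) (8 * pi)"
      if "0 < M" "Lphi_bound \<phi> p M (\<lambda>\<xi>. Re (f \<xi>))" for M
      using Lam_growth_of_Lphi_bound[OF \<phi> _ tailC K p harm qr cont _ that(2)] C that(1) by simp
    then show "Lam_growth \<phi> p K0 f (8 * pi * (1 + C) * K * M) (8 * pi)"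
      if "0 < M" "Lphi_bound \<phi> p M (\<lambda>\<xi>. Re (f \<xi>))" for M using that .
    show "(\<lambda>\<xi>. Re (f \<xi>)) \<in> Lphi \<phi> p \<longleftrightarrow> (\<exists>A>0. \<exists>B>0. Lam_growth \<phi> p K0 f A B)"
    proof
      assume "(\<lambda>\<xi>. Re (f \<xi>)) \<in> Lphi \<phi> p"
      then obtain M where M: "0 < M" "Lphi_bound \<phi> p M (\<lambda>\<xi>. Re (f \<xi>))"
        by (auto simp: Lphi_def)
      have "0 < 8 * pi * (1 + C) * K * M" using C K M by simp
      then show "\<exists>A>0. \<exists>B>0. Lam_growth \<phi> p K0 f A B"
        using quant[OF M] by (intro exI[of _ "8 * pi * (1 + C) * K * M"] conjI exI[of _ "8 * pi"]) auto
    next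
      assume "\<exists>A>0. \<exists>B>0. Lam_growth \<phi> p K0 f A B"
      then show "(\<lambda>\<xi>. Re (f \<xi>)) \<in> Lphi \<phi> p"
        using Lphi_of_Lam_growth[OF dini p K(2) harm cont] by blast
    qed
  qed (use C in simp)
qed simp

end
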